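(* Let $\tau_k=1/(1+\log k)$ for $k\ge1$, and let $D_t:l_1\to l_1$ be the diagonal operator $D_t(\xi_k):=(\tau_k\xi_k)$. Then $D_t$ is super weakly compact, but $D_t$ does not have martingale type $p$ for any $p>1$, and hence $D_t$ does not factor through a superreflexive Banach space.
   Context: Operators are bounded and linear. Let $\Delta_k^{(j)}=[\frac{j-1}{2^k},\frac j{2^k})$; for $k\ge1$, $1\le j\le2^{k-1}$, the Haar function $\chi_k^{(j)}$ on $[0,1)$ equals $2^{(k-1)/2}$ on $\Delta_k^{(2j-1)}$, $-2^{(k-1)/2}$ on $\Delta_k^{(2j)}$, and $0$ otherwise. Let $\mathbb D_1^n=\{(k,j):1\le k\le n,\ 1\le j\le2^{k-1}\}$. For a vector-valued function $f$ on $[0,1)$, $\|f|L_p\|=\big(\int_0^1\|f(t)\|^pdt\big)^{1/p}$ ($1<p<\infty$). For an operator $T:X\to Y$ between Banach spaces, the Haar type $p$ ideal norm $\tau_p(T|\mathcal H(\mathbb D_1^n))$ is the smallest constant $c\ge0$ such that $$\Big\|\sum_{(k,j)\in\mathbb D_1^n}Tx_k^{(j)}\chi_k^{(j)}\Big|L_p\Big\|\le c\Big(\sum_{k=1}^n\Big\|\sum_{j=1}^{2^{k-1}}x_k^{(j)}\chi_k^{(j)}\Big|L_p\Big\|^p\Big)^{1/p}$$ for all $(x_k^{(j)})\subseteq X$. $T$ has martingale type $p$ if the sequence $(\tau_p(T|\mathcal H(\mathbb D_1^n)))_n$ is bounded. $T$ is weakly compact if the image of the closed unit ball of $X$ is relatively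 weakly compact in $Y$. For an ultrafilter $\mathcal U$ on an index set $I$, $X^{\mathcal U}$ is the quotient of the space of bounded families $(x_i)_{i\in I}$ in $X$ by the subspace of families with $\lim_{\mathcal U}\|x_i\|=0$, and $T^{\mathcal U}:X^{\mathcal U}\to Y^{\mathcal U}$ is induced by $(x_i)\mapsto(Tx_i)$. $T$ is super weakly compact if all its ultrapowers $T^{\mathcal U}$ are weakly compact. A Banach space $Z$ is superreflexive if every Banach space finitely representable in $Z$ is reflexive. $T$ factors through $Z$ if $T=BA$ with operators $A:X\to Z$, $B:Z\to Y$. *)

theory Defs
  imports "HOL-Analysis.Analysis"
begin

section \<open>The Banach space $l_1$\<close>

text \<open>Real sequences; the coordinate $\xi_{k}$, $k \ge 1$, is stored at position \<open>k - 1\<close>.\<close>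

typedef ell1 = "{x :: nat \<Rightarrow> real. summable (\<lambda>k. \<bar>x k\<bar>)}"
  morphisms seq_of_ell1 Abs_ell1
  by (rule exI[of _ "\<lambda>_. 0"]) simp

setup_lifting type_definition_ell1

lemma abs_summable_add:
  fixes f g :: "nat \<Rightarrow> real"
  assumes "summable (\<lambda>k. \<bar>f k\<bar>)" "summable (\<lambda>k. \<bar>g k\<bar>)"
  shows "summable (\<lambda>k. \<bar>f k + g k\<bar>)"
  by (rule summable_comparison_test'[OF summable_add[OF assms], of 0]) (simp add: abs_triangle_ineq)

lemma abs_summable_diff:
  fixes f g :: "nat \<Rightarrow> real"
  assumes "summable (\<lambda>k. \<bar>f k\<bar>)" "summable (\<lambda>k. \<bar>g k\<bar>)"
  shows "summable (\<lambda>k. \<bar>f k - g k\<bar>)"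
  using abs_summable_add[of f "\<lambda>k. - g k"] assms by simp

instantiation ell1 :: real_vector
begin

lift_definition zero_ell1 :: ell1 is "\<lambda>_. 0" by simp
lift_definition plus_ell1 :: "ell1 \<Rightarrow> ell1 \<Rightarrow> ell1" is "\<lambda>x y k. x k + y k"
  by (rule abs_summable_add)
lift_definition minus_ell1 :: "ell1 \<Rightarrow> ell1 \<Rightarrow> ell1" is "\<lambda>x y k. x k - y k"
  by (rule abs_summable_diff)
lift_definition uminus_ell1 :: "ell1 \<Rightarrow> ell1" is "\<lambda>x k. - x k" by simp
lift_definition scaleR_ell1 :: "real \<Rightarrow> ell1 \<Rightarrow> ell1" is "\<lambda>r x k. r * x k"
  by (simp add: abs_mult summable_mult)

instance
  by standard (transfer, simp add: algebra_simps)+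

end

instantiation ell1 :: real_normed_vector
begin

lift_definition norm_ell1 :: "ell1 \<Rightarrow> real" is "\<lambda>x. \<Sum>k. \<bar>x k\<bar>" .

definition "sgn (x::ell1) = x /\<^sub>R norm x"
definition "dist (x::ell1) y = norm (x - y)"
definition "(uniformity :: (ell1 \<times> ell1) filter) = (INF e\<in>{0<..}. principal {(x, y). dist x y < e})"
definition "open (U :: ell1 set) = (\<forall>x\<in>U. \<forall>\<^sub>F (x', y) in uniformity. x' = x \<longrightarrow> y \<in> U)"

instance
proof
  fix x y :: ell1 and a :: real
  show "(norm x = 0) = (x = 0)"
    by transfer (auto simp: suminf_eq_zero_iff fun_eq_iff)
  show "norm (x + y) \<le> norm x + norm y"
    by transfer (auto simp: suminf_add intro!: suminf_le abs_summable_add summable_add)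
  show "norm (a *\<^sub>R x) = \<bar>a\<bar> * norm x"
    by transfer (simp add: abs_mult suminf_mult)
qed (fact sgn_ell1_def dist_ell1_def uniformity_ell1_def open_ell1_def)+

end

instance ell1 :: banach
proof
  fix X :: "nat \<Rightarrow> ell1"
  assume X: "Cauchy X"
  define c where "c n k = seq_of_ell1 (X n) k" for n k
  have summ: "summable (\<lambda>k. \<bar>c n k\<bar>)" for n
    using seq_of_ell1[of "X n"] by (simp add: c_def)
  have norm_diff: "norm (X n - X m) = (\<Sum>k. \<bar>c n k - c m k\<bar>)" for n m
    unfolding c_def by transfer simp
  have part: "(\<Sum>k<K. \<bar>c n k - c m k\<bar>) \<le> norm (X n - X m)" for n m K
    unfolding norm_diff by (rule sum_le_suminf) (auto intro: abs_summable_diff summ)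
  have "Cauchy (\<lambda>n. c n k)" for k
  proof (rule metric_CauchyI)
    fix e :: real
    assume "0 < e"
    then obtain N where N: "\<And>m n. m \<ge> N \<Longrightarrow> n \<ge> N \<Longrightarrow> dist (X m) (X n) < e"
      using X by (meson metric_CauchyD)
    have le: "dist (c m k) (c n k) \<le> dist (X m) (X n)" for m n
    proof -
      have "\<bar>c m k - c n k\<bar> \<le> (\<Sum>i<Suc k. \<bar>c m i - c n i\<bar>)"
        by (rule member_le_sum) simp_all
      also have "\<dots> \<le> norm (X m - X n)"
        by (rule part)
      finally show ?thesis
        by (simp only: dist_norm real_norm_def)
    qed
    show "\<exists>N. \<forall>m\<ge>N. \<forall>n\<ge>N. dist (c m k) (c n k) < e"
      by (intro exI[of _ N] allI impI order.strict_trans1[OF le N])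
  qed
  then have "\<exists>l. (\<lambda>n. c n k) \<longlonglongrightarrow> l" for k
    by (simp add: Cauchy_convergent_iff convergent_def)
  then obtain l where l: "\<And>k. (\<lambda>n. c n k) \<longlonglongrightarrow> l k"
    by metis
  have bound: "(\<Sum>k<K. \<bar>c n k - l k\<bar>) \<le> e"
    if N: "\<And>m n. m \<ge> N \<Longrightarrow> n \<ge> N \<Longrightarrow> norm (X m - X n) < e" and n: "n \<ge> N" for e N n K
  proof (rule tendsto_upperbound)
    show "(\<lambda>m. \<Sum>k<K. \<bar>c n k - c m k\<bar>) \<longlonglongrightarrow> (\<Sum>k<K. \<bar>c n k - l k\<bar>)"
      by (intro tendsto_intros l)
    show "\<forall>\<^sub>F m in sequentially. (\<Sum>k<K. \<bar>c n k - c m k\<bar>) \<le> e"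
      using eventually_ge_at_top[of N]
      by eventually_elim (intro order.trans[OF part less_imp_le] N n)
  qed simp
  have ex: "\<exists>N. \<forall>m\<ge>N. \<forall>n\<ge>N. norm (X m - X n) < e" if "e > 0" for e
    using X that by (simp add: Cauchy_def dist_norm)
  have summ_diff: "summable (\<lambda>k. \<bar>c n k - l k\<bar>)"
    if "\<And>m n. m \<ge> N \<Longrightarrow> n \<ge> N \<Longrightarrow> norm (X m - X n) < e" "n \<ge> N" for e N n
    by (rule bounded_imp_summable[where B=e])
       (simp, unfold lessThan_Suc_atMost[symmetric], rule bound[OF that])
  obtain N1 where N1: "\<And>m n. m \<ge> N1 \<Longrightarrow> n \<ge> N1 \<Longrightarrow> norm (X m - X n) < 1"
    using ex[of 1] by auto
  have "summable (\<lambda>k. \<bar>c N1 k - l k\<bar>)"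
    by (rule summ_diff[of N1 1 N1]) (simp_all add: N1)
  then have "summable (\<lambda>k. \<bar>l k\<bar>)"
    using abs_summable_diff[OF summ[of N1]] by fastforce
  then have L: "seq_of_ell1 (Abs_ell1 l) = l"
    by (simp add: Abs_ell1_inverse)
  have "X \<longlonglongrightarrow> Abs_ell1 l"
  proof (rule LIMSEQ_I)
    fix r :: real
    assume "0 < r"
    then obtain N where N: "\<And>m n. m \<ge> N \<Longrightarrow> n \<ge> N \<Longrightarrow> norm (X m - X n) < r / 2"
      using ex[of "r / 2"] by auto
    have "norm (X n - Abs_ell1 l) < r" if "n \<ge> N" for n
    proof -
      have "norm (X n - Abs_ell1 l) = (\<Sum>k. \<bar>c n k - l k\<bar>)"
        unfolding c_def by (simp add: norm_ell1.rep_eq minus_ell1.rep_eq L)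
      also have "\<dots> \<le> r / 2"
        using bound[OF N that] summ_diff[OF N that] by (intro suminf_le_const) auto
      finally show ?thesis using \<open>0 < r\<close> by simp
    qed
    then show "\<exists>no. \<forall>n\<ge>no. norm (X n - Abs_ell1 l) < r"
      by blast
  qed
  then show "convergent X"
    by (auto simp: convergent_def)
qed

section \<open>The diagonal operator\<close>

definition tau :: "nat \<Rightarrow> real" where
  "tau k = 1 / (1 + ln (real k))"

lemma tau_nonneg: "0 \<le> tau (Suc k)"
  by (simp add: tau_def)

lemma tau_le_one: "tau (Suc k) \<le> 1"
proof -
  have "0 \<le> ln (real (Suc k))"
    by (rule ln_ge_zero) simp
  then show ?thesis
    unfolding tau_def by (subst divide_le_eq_1_pos) linarith+
qed

lemma abs_tau_mult_le: "\<bar>tau (Suc k) * a\<bar> \<le> \<bar>a\<bar>"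
  unfolding abs_mult using tau_nonneg[of k] tau_le_one[of k]
  by (intro mult_left_le_one_le) simp_all

lift_definition D_t :: "ell1 \<Rightarrow> ell1" is "\<lambda>\<xi> k. tau (Suc k) * \<xi> k"
  by (erule summable_comparison_test'[where N=0]) (simp only: real_norm_def abs_idempotent abs_tau_mult_le)

lemma bounded_linear_D_t: "bounded_linear D_t"
proof (rule bounded_linear_intro[where K=1])
  show "D_t (x + y) = D_t x + D_t y" "D_t (r *\<^sub>R x) = r *\<^sub>R D_t x" for x y r
    by (transfer, simp add: algebra_simps)+
  fix x
  have summ: "summable (\<lambda>k. \<bar>seq_of_ell1 x k\<bar>)" "summable (\<lambda>k. \<bar>seq_of_ell1 (D_t x) k\<bar>)"
    using seq_of_ell1[of x] seq_of_ell1[of "D_t x"] by simp_all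
  have "\<bar>seq_of_ell1 (D_t x) k\<bar> \<le> \<bar>seq_of_ell1 x k\<bar>" for k
    unfolding D_t.rep_eq by (rule abs_tau_mult_le)
  then show "norm (D_t x) \<le> norm x * 1"
    unfolding norm_ell1.rep_eq using summ by (simp add: suminf_le)
qed

section \<open>Haar functions and martingale type\<close>

definition dyadic :: "nat \<Rightarrow> nat \<Rightarrow> real set" where
  "dyadic k j = {(real j - 1) / 2 ^ k ..< real j / 2 ^ k}"

definition haar :: "nat \<Rightarrow> nat \<Rightarrow> real \<Rightarrow> real" where
  "haar k j t =
     (if t \<in> dyadic k (2 * j - 1) then 2 powr ((real k - 1) / 2)
      else if t \<in> dyadic k (2 * j) then - (2 powr ((real k - 1) / 2))
      else 0)"

definition haar_index :: "nat \<Rightarrow> (nat \<times> nat) set" where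
  "haar_index n = {(k, j). 1 \<le> k \<and> k \<le> n \<and> 1 \<le> j \<and> j \<le> 2 ^ (k - 1)}"

definition Lp_norm :: "real \<Rightarrow> (real \<Rightarrow> 'a::real_normed_vector) \<Rightarrow> real" where
  "Lp_norm p f = (LINT t:{0..<1}|lborel. norm (f t) powr p) powr (1 / p)"

definition haar_type_bound ::
    "real \<Rightarrow> nat \<Rightarrow> ('a::real_normed_vector \<Rightarrow> 'b::real_normed_vector) \<Rightarrow> real \<Rightarrow> bool" where
  "haar_type_bound p n T c \<longleftrightarrow>
     (\<forall>x :: nat \<Rightarrow> nat \<Rightarrow> 'a.
        Lp_norm p (\<lambda>t. \<Sum>(k, j)\<in>haar_index n. haar k j t *\<^sub>R T (x k j))
          \<le> c * (\<Sum>k = 1..n. Lp_norm p (\<lambda>t. \<Sum>j = 1..2 ^ (k - 1). haar k j t *\<^sub>R x k j) powr p)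
                 powr (1 / p))"

text \<open>For a bounded linear operator the set below is nonempty, so the infimum is a genuine one
  (and it is attained, the condition being closed in \<open>c\<close>).\<close>

definition haar_type_norm ::
    "real \<Rightarrow> nat \<Rightarrow> ('a::real_normed_vector \<Rightarrow> 'b::real_normed_vector) \<Rightarrow> real" where
  "haar_type_norm p n T = Inf {c. 0 \<le> c \<and> haar_type_bound p n T c}"

definition martingale_type ::
    "real \<Rightarrow> ('a::real_normed_vector \<Rightarrow> 'b::real_normed_vector) \<Rightarrow> bool" where
  "martingale_type p T \<longleftrightarrow> bounded (range (\<lambda>n. haar_type_norm p n T))"

section \<open>Normed spaces on carrier sets\<close>

text \<open>Ultrapowers depend on an ultrafilter, and superreflexivity quantifies over Banach spaces;
  neither can be done with type classes, so for these notions normed spaces are given by an explicit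
  carrier and explicit operations.\<close>

record 'a nspace =
  carrier :: "'a set"
  zero :: 'a ("\<zero>\<index>")
  add :: "'a \<Rightarrow> 'a \<Rightarrow> 'a" (infixl "\<oplus>\<index>" 65)
  scale :: "real \<Rightarrow> 'a \<Rightarrow> 'a" (infixr "\<odot>\<index>" 75)
  nrm :: "'a \<Rightarrow> real"

locale normed_space =
  fixes X :: "'a nspace" (structure)
  assumes zero_closed: "\<zero> \<in> carrier X"
    and add_closed: "x \<in> carrier X \<Longrightarrow> y \<in> carrier X \<Longrightarrow> x \<oplus> y \<in> carrier X"
    and scale_closed: "x \<in> carrier X \<Longrightarrow> r \<odot> x \<in> carrier X"
    and add_assoc: "x \<in> carrier X \<Longrightarrow> y \<in> carrier X \<Longrightarrow> z \<in> carrier X \<Longrightarrow>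
      (x \<oplus> y) \<oplus> z = x \<oplus> (y \<oplus> z)"
    and add_comm: "x \<in> carrier X \<Longrightarrow> y \<in> carrier X \<Longrightarrow> x \<oplus> y = y \<oplus> x"
    and add_zero: "x \<in> carrier X \<Longrightarrow> x \<oplus> \<zero> = x"
    and add_inverse: "x \<in> carrier X \<Longrightarrow> \<exists>y\<in>carrier X. x \<oplus> y = \<zero>"
    and scale_add: "x \<in> carrier X \<Longrightarrow> y \<in> carrier X \<Longrightarrow> r \<odot> (x \<oplus> y) = r \<odot> x \<oplus> r \<odot> y"
    and add_scale: "x \<in> carrier X \<Longrightarrow> (r + s) \<odot> x = r \<odot> x \<oplus> s \<odot> x"
    and scale_scale: "x \<in> carrier X \<Longrightarrow> r \<odot> (s \<odot> x) = (r * s) \<odot> x"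
    and scale_one: "x \<in> carrier X \<Longrightarrow> 1 \<odot> x = x"
    and nrm_eq_zero: "x \<in> carrier X \<Longrightarrow> nrm X x = 0 \<longleftrightarrow> x = \<zero>"
    and nrm_triangle: "x \<in> carrier X \<Longrightarrow> y \<in> carrier X \<Longrightarrow> nrm X (x \<oplus> y) \<le> nrm X x + nrm X y"
    and nrm_scale: "x \<in> carrier X \<Longrightarrow> nrm X (r \<odot> x) = \<bar>r\<bar> * nrm X x"

definition nspace_dist :: "'a nspace \<Rightarrow> 'a \<Rightarrow> 'a \<Rightarrow> real" where
  "nspace_dist X x y = nrm X (x \<oplus>\<^bsub>X\<^esub> (- 1) \<odot>\<^bsub>X\<^esub> y)"

locale banach_space = normed_space +
  assumes complete:
    "(\<And>n. s n \<in> carrier X) \<Longrightarrow>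
     (\<And>e. e > 0 \<Longrightarrow> \<exists>N. \<forall>m\<ge>N. \<forall>n\<ge>N. nspace_dist X (s m) (s n) < e) \<Longrightarrow>
     \<exists>l\<in>carrier X. (\<lambda>n. nspace_dist X (s n) l) \<longlonglongrightarrow> 0"

definition nspace_of :: "'a::real_normed_vector itself \<Rightarrow> 'a nspace" where
  "nspace_of _ = \<lparr>carrier = UNIV, zero = 0, add = (+), scale = (*\<^sub>R), nrm = norm\<rparr>"

lemma banach_space_nspace_of: "banach_space (nspace_of TYPE('a::banach))"
proof
  fix s :: "nat \<Rightarrow> 'a"
  assume "\<And>e. e > 0 \<Longrightarrow> \<exists>N. \<forall>m\<ge>N. \<forall>n\<ge>N. nspace_dist (nspace_of TYPE('a)) (s m) (s n) < e"
  then have "Cauchy s"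
    by (intro metric_CauchyI) (simp add: nspace_dist_def nspace_of_def dist_norm)
  then obtain l where "s \<longlonglongrightarrow> l"
    by (auto simp: Cauchy_convergent_iff convergent_def)
  then show "\<exists>l\<in>carrier (nspace_of TYPE('a)). (\<lambda>n. nspace_dist (nspace_of TYPE('a)) (s n) l) \<longlonglongrightarrow> 0"
    by (auto simp: nspace_dist_def nspace_of_def intro!: exI[of _ l] tendsto_norm_zero LIM_zero)
next
  fix x :: 'a
  show "\<exists>y\<in>carrier (nspace_of TYPE('a)). x \<oplus>\<^bsub>nspace_of TYPE('a)\<^esub> y = \<zero>\<^bsub>nspace_of TYPE('a)\<^esub>"
    by (rule bexI[of _ "- x"]) (simp_all add: nspace_of_def)
qed (simp_all add: nspace_of_def algebra_simps norm_triangle_ineq)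

definition bounded_operator :: "'a nspace \<Rightarrow> 'b nspace \<Rightarrow> ('a \<Rightarrow> 'b) \<Rightarrow> bool" where
  "bounded_operator X Y T \<longleftrightarrow>
     (\<forall>x\<in>carrier X. T x \<in> carrier Y) \<and>
     (\<forall>x\<in>carrier X. \<forall>y\<in>carrier X. T (x \<oplus>\<^bsub>X\<^esub> y) = T x \<oplus>\<^bsub>Y\<^esub> T y) \<and>
     (\<forall>r. \<forall>x\<in>carrier X. T (r \<odot>\<^bsub>X\<^esub> x) = r \<odot>\<^bsub>Y\<^esub> T x) \<and>
     (\<exists>K. \<forall>x\<in>carrier X. nrm Y (T x) \<le> K * nrm X x)"

definition unit_ball :: "'a nspace \<Rightarrow> 'a set" where
  "unit_ball X = {x \<in> carrier X. nrm X x \<le> 1}"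

text \<open>Functionals vanish off the carrier, so that equal functionals are equal as functions.\<close>

definition dual :: "'a nspace \<Rightarrow> ('a \<Rightarrow> real) nspace" where
  "dual X =
     \<lparr>carrier = {f. bounded_operator X (nspace_of TYPE(real)) f \<and> (\<forall>x. x \<notin> carrier X \<longrightarrow> f x = 0)},
      zero = (\<lambda>x. 0),
      add = (\<lambda>f g x. f x + g x),
      scale = (\<lambda>r f x. r * f x),
      nrm = (\<lambda>f. SUP x\<in>unit_ball X. \<bar>f x\<bar>)\<rparr>"

definition reflexive :: "'a nspace \<Rightarrow> bool" where
  "reflexive X \<longleftrightarrow>
     (\<forall>\<phi>\<in>carrier (dual (dual X)). \<exists>x\<in>carrier X. \<forall>f\<in>carrier (dual X). \<phi> f = f x)"

definition weak_topology :: "'a nspace \<Rightarrow> 'a topology" where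
  "weak_topology X =
     topology_generated_by {{x \<in> carrier X. f x \<in> V} | f V. f \<in> carrier (dual X) \<and> open V}"

definition weakly_compact :: "'a nspace \<Rightarrow> 'b nspace \<Rightarrow> ('a \<Rightarrow> 'b) \<Rightarrow> bool" where
  "weakly_compact X Y T \<longleftrightarrow>
     compactin (weak_topology Y) (weak_topology Y closure_of (T ` unit_ball X))"

section \<open>Ultrapowers and super weakly compact operators\<close>

definition ultrafilter :: "'i filter \<Rightarrow> bool" where
  "ultrafilter U \<longleftrightarrow> U \<noteq> bot \<and> (\<forall>P. eventually P U \<or> eventually (\<lambda>i. \<not> P i) U)"

definition bounded_families :: "('i \<Rightarrow> 'a::real_normed_vector) set" where
  "bounded_families = {x. bounded (range x)}"

definition ultra_rel ::
    "'i filter \<Rightarrow> (('i \<Rightarrow> 'a::real_normed_vector) \<times> ('i \<Rightarrow> 'a)) set" where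
  "ultra_rel U = {(x, y). x \<in> bounded_families \<and> y \<in> bounded_families \<and>
     ((\<lambda>i. norm (x i - y i)) \<longlongrightarrow> 0) U}"

text \<open>Elements are the cosets of the subspace of null families, with the operations of the quotient
  and the quotient norm of the supremum norm. A union over the representatives of a coset merely
  picks the common coset of the results.\<close>

definition ultrapower :: "'i filter \<Rightarrow> ('i \<Rightarrow> 'a::real_normed_vector) set nspace" where
  "ultrapower U =
     \<lparr>carrier = bounded_families // ultra_rel U,
      zero = ultra_rel U `` {\<lambda>i. 0},
      add = (\<lambda>a b. \<Union>x\<in>a. \<Union>y\<in>b. ultra_rel U `` {\<lambda>i. x i + y i}),
      scale = (\<lambda>r a. \<Union>x\<in>a. ultra_rel U `` {\<lambda>i. r *\<^sub>R x i}),
      nrm = (\<lambda>a. INF x\<in>a. SUP i. norm (x i))\<rparr>"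

definition ultrapower_op ::
    "'i filter \<Rightarrow> ('a::real_normed_vector \<Rightarrow> 'b::real_normed_vector) \<Rightarrow>
     ('i \<Rightarrow> 'a) set \<Rightarrow> ('i \<Rightarrow> 'b) set" where
  "ultrapower_op U T a = (\<Union>x\<in>a. ultra_rel U `` {\<lambda>i. T (x i)})"

text \<open>The index sets are the types \<open>'i\<close>; a statement with a free \<open>'i\<close> covers all of them.\<close>

definition super_weakly_compact ::
    "'i itself \<Rightarrow> ('a::real_normed_vector \<Rightarrow> 'b::real_normed_vector) \<Rightarrow> bool" where
  "super_weakly_compact _ T \<longleftrightarrow>
     (\<forall>U :: 'i filter. ultrafilter U \<longrightarrow>
        weakly_compact (ultrapower U) (ultrapower U) (ultrapower_op U T))"

section \<open>Superreflexive spaces and factorization\<close>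

definition subspace_of :: "'a set \<Rightarrow> 'a nspace \<Rightarrow> bool" where
  "subspace_of E X \<longleftrightarrow>
     E \<subseteq> carrier X \<and> \<zero>\<^bsub>X\<^esub> \<in> E \<and> (\<forall>x\<in>E. \<forall>y\<in>E. x \<oplus>\<^bsub>X\<^esub> y \<in> E) \<and> (\<forall>r. \<forall>x\<in>E. r \<odot>\<^bsub>X\<^esub> x \<in> E)"

definition finite_dim_subspace :: "'a set \<Rightarrow> 'a nspace \<Rightarrow> bool" where
  "finite_dim_subspace E X \<longleftrightarrow>
     (\<exists>B. finite B \<and> B \<subseteq> carrier X \<and> E = \<Inter> {S. subspace_of S X \<and> B \<subseteq> S})"

text \<open>An isomorphism \<open>u\<close> from \<open>E\<close> onto its range with $\|u\|\,\|u^{-1}\| \le 1 + \varepsilon$, scaled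
  so that $\|u^{-1}\| \le 1$.\<close>

definition finitely_representable :: "'a nspace \<Rightarrow> 'b nspace \<Rightarrow> bool" where
  "finitely_representable W Z \<longleftrightarrow>
     (\<forall>E \<epsilon>. finite_dim_subspace E W \<and> \<epsilon> > 0 \<longrightarrow>
        (\<exists>u. bounded_operator (W\<lparr>carrier := E\<rparr>) Z u \<and>
             (\<forall>x\<in>E. nrm W x \<le> nrm Z (u x) \<and> nrm Z (u x) \<le> (1 + \<epsilon>) * nrm W x)))"

text \<open>\<open>W\<close> ranges over the Banach spaces whose underlying set is a subset of the type \<open>'w\<close>. Already
  for \<open>'w = nat \<Rightarrow> real\<close> this is the full notion: a nonreflexive Banach space has a nonreflexive
  separable closed subspace, and a separable Banach space has at most continuum many elements.
  In any case a smaller \<open>'w\<close> gives a weaker condition, hence a stronger theorem wherever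
  superreflexivity occurs as a hypothesis.\<close>

definition superreflexive :: "'w itself \<Rightarrow> 'z nspace \<Rightarrow> bool" where
  "superreflexive _ Z \<longleftrightarrow>
     (\<forall>W :: 'w nspace. banach_space W \<and> finitely_representable W Z \<longrightarrow> reflexive W)"

definition factors_through ::
    "'z::real_normed_vector itself \<Rightarrow> ('x::real_normed_vector \<Rightarrow> 'y::real_normed_vector) \<Rightarrow> bool" where
  "factors_through _ T \<longleftrightarrow>
     (\<exists>(A :: 'x \<Rightarrow> 'z) (B :: 'z \<Rightarrow> 'y). bounded_linear A \<and> bounded_linear B \<and> T = B \<circ> A)"

end

theory Submission
  imports Defs "HOL-Real_Asymp.Real_Asymp"
begin

text \<open>Since $\tau_k \to 0$, the operator $D_t$ is compact; hence each of its ultrapowers maps the unit ball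
  into a norm compact subset of the diagonal copy of $l_1$, and is weakly compact. If $r_k$ are the
  Rademacher functions and $e_k$ the unit vectors, then $\sum_{k \le n} r_k D_t e_k$ has norm
  $\sum_{k \le n} \tau_k \ge n / (1 + \log n)$ everywhere, which no multiple of $n^{1/p}$ dominates.
  Finally, if $D_t$ factors through $Z$, then $Z$ contains copies of $l_1^n$ with distortion of order
  $\log n$ only. By James' blocking argument the distortion of copies of $l_1^{n^j}$ is at least the
  $j$-th power of the optimal distortion for $l_1^n$, so the latter is 1: the nonreflexive space $l_1$
  is finitely representable in $Z$.\<close>

section \<open>Weak compactness of the ultrapowers\<close>

text \<open>The weights tend to 0, but slowly enough for both negative results. Since log(n^j) = j
  log n, the lower constants for copies of $l_1^{n^j}$ in Z decay at most like 1/j for fixed n,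
  whereas blocking would make them decay geometrically in j if the best constant for $l_1^n$ were
  below 1. Letting j grow turns logarithmic control over all dimensions into constants arbitrarily
  close to 1 in each dimension. A loss of order n^(-a) would not do, because along powers of n it is
  itself geometric. Compactness acts through limits along the ultrafilter: a family with values in a
  norm compact set differs from a constant family by a null family, so its class is
  diagonal.\<close>

lemma zero_in_dual: "(\<lambda>x. 0) \<in> carrier (dual X)"
  unfolding dual_def bounded_operator_def nspace_of_def by (simp add: exI[of _ "0::real"])

text \<open>The zero functional makes the whole carrier a subbasic open set.\<close>

lemma topspace_weak_topology: "topspace (weak_topology X) = carrier X"
proof -
  have "carrier X = {x \<in> carrier X. (\<lambda>x. 0::real) x \<in> UNIV}"
    by simp
  then have "carrier X \<in> {{x \<in> carrier X. f x \<in> V} | f V. f \<in> carrier (dual X) \<and> open V}"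
    using zero_in_dual[of X] open_UNIV by blast
  then show ?thesis
    unfolding weak_topology_def topology_generated_by_topspace by auto
qed

lemma openin_weak_topology_vimage:
  assumes "f \<in> carrier (dual X)" "open V"
  shows "openin (weak_topology X) {x \<in> carrier X. f x \<in> V}"
  unfolding weak_topology_def by (rule topology_generated_by_Basis) (use assms in blast)

text \<open>The property survives intersections and unions, so only subbasic sets need an argument.
  There a closed ball of the real line inside \<open>V\<close> is pulled back along
  \<open>f\<close>.\<close>

lemma weak_topology_closed_nbhd:
  assumes "openin (weak_topology X) S" "x \<in> S"
  shows "\<exists>U C. openin (weak_topology X) U \<and> closedin (weak_topology X) C \<and> x \<in> U \<and> U \<subseteq> C \<and> C \<subseteq> S"
proof -
  have "generate_topology_on {{x \<in> carrier X. f x \<in> V} | f V. f \<in> carrier (dual X) \<and> open V} S"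
    using assms(1) unfolding weak_topology_def by (rule openin_topology_generated_by)
  then show ?thesis
    using assms(2)
  proof (induction S)
    case (Int S T)
    then have "x \<in> S" "x \<in> T"
      by auto
    obtain U C where U: "openin (weak_topology X) U" "closedin (weak_topology X) C"
      "x \<in> U" "U \<subseteq> C" "C \<subseteq> S"
      using Int.IH(1)[OF \<open>x \<in> S\<close>] by blast
    obtain U' C' where U': "openin (weak_topology X) U'" "closedin (weak_topology X) C'"
      "x \<in> U'" "U' \<subseteq> C'" "C' \<subseteq> T"
      using Int.IH(2)[OF \<open>x \<in> T\<close>] by blast
    have "openin (weak_topology X) (U \<inter> U')" "closedin (weak_topology X) (C \<inter> C')"
      using U U' by (auto intro: openin_Int closedin_Int)
    moreover have "x \<in> U \<inter> U'" "U \<inter> U' \<subseteq> C \<inter> C'" "C \<inter> C' \<subseteq> S \<inter> T"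
      using U U' by auto
    ultimately show ?case
      by blast
  next
    case (UN \<K>)
    then obtain S where S: "S \<in> \<K>" "x \<in> S"
      by (elim UnionE)
    obtain U C where "openin (weak_topology X) U" "closedin (weak_topology X) C"
      "x \<in> U" "U \<subseteq> C" "C \<subseteq> S"
      using UN.IH[OF S] by (elim exE conjE)
    moreover from this have "C \<subseteq> \<Union> \<K>"
      using S by (meson Union_upper subset_trans)
    ultimately show ?case
      by (intro exI[of _ U] exI[of _ C]) simp
  next
    case (Basis S)
    obtain f V where f: "f \<in> carrier (dual X)" and V: "open V"
      and S: "S = {x \<in> carrier X. f x \<in> V}"
      using Basis.hyps by auto
    then have "f x \<in> V" "x \<in> carrier X"
      using Basis.prems by auto
    then obtain e where e: "e > 0" "cball (f x) e \<subseteq> V"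
      using V open_contains_cball_eq by metis
    let ?U = "{y \<in> carrier X. f y \<in> ball (f x) e}" and ?C = "{y \<in> carrier X. f y \<in> cball (f x) e}"
    have "topspace (weak_topology X) - ?C = {y \<in> carrier X. f y \<in> - cball (f x) e}"
      by (auto simp: topspace_weak_topology)
    then have "closedin (weak_topology X) ?C"
      using openin_weak_topology_vimage[OF f, of "- cball (f x) e"]
      by (auto simp: closedin_def topspace_weak_topology)
    moreover have "openin (weak_topology X) ?U"
      by (rule openin_weak_topology_vimage[OF f open_ball])
    moreover have "x \<in> ?U" "?U \<subseteq> ?C" "?C \<subseteq> S"
      using \<open>x \<in> carrier X\<close> S e by auto
    ultimately show ?case
      by (intro exI[of _ ?U] exI[of _ ?C]) simp
  qed auto
qed

text \<open>Regularity gives compact closures of relatively compact sets; a Hausdorff argument would need the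
  Hahn--Banach theorem for the ultrapower.\<close>

lemma regular_space_weak_topology: "regular_space (weak_topology X)"
  unfolding neighbourhood_base_of_closedin[symmetric] neighbourhood_base_of
  by (intro allI impI weak_topology_closed_nbhd) auto

text \<open>Adding the complement of the closure turns a cover of the closure into a cover of
  \<open>K\<close>. The union of a finite subcover contains the closure too: regularity separates
  \<open>K\<close> from everything outside the union, so no point there adheres to
  \<open>S\<close>.\<close>

lemma compactin_closure_of_subset_compactin:
  assumes X: "regular_space X" and K: "compactin X K" and S: "S \<subseteq> K"
  shows "compactin X (X closure_of S)"
  unfolding compactin_def
proof (intro conjI allI impI)
  fix \<U>
  assume \<U>: "Ball \<U> (openin X) \<and> X closure_of S \<subseteq> \<Union> \<U>"
  define \<V> where "\<V> = insert (topspace X - X closure_of S) \<U>"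
  have "Ball \<V> (openin X)" "K \<subseteq> \<Union> \<V>"
    using \<U> compactin_subset_topspace[OF K] by (auto simp: \<V>_def openin_diff)
  then obtain \<F> where \<F>: "finite \<F>" "\<F> \<subseteq> \<V>" "K \<subseteq> \<Union> \<F>"
    using K unfolding compactin_def by metis
  have op: "openin X (\<Union> \<F>)"
    using \<F>(2) \<open>Ball \<V> (openin X)\<close> by (intro openin_Union) blast
  have "X closure_of S \<subseteq> \<Union> \<F>"
  proof
    fix y
    assume y: "y \<in> X closure_of S"
    show "y \<in> \<Union> \<F>"
    proof (rule ccontr)
      assume ny: "y \<notin> \<Union> \<F>"
      have "closedin X (topspace X - \<Union> \<F>)" "disjnt K (topspace X - \<Union> \<F>)"
        using op \<F>(3) by (auto simp: disjnt_def)
      then obtain U V where "openin X V" "K \<subseteq> U" "topspace X - \<Union> \<F> \<subseteq> V" "disjnt U V"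
        using regular_space_compact_closed_separation[OF X K] by metis
      moreover have "y \<in> V"
        using calculation ny in_closure_of[of y X S] y by blast
      ultimately show False
        using y S unfolding in_closure_of disjnt_iff by (meson subsetD)
    qed
  qed
  then have "X closure_of S \<subseteq> \<Union> (\<F> - {topspace X - X closure_of S})"
    by blast
  then show "\<exists>\<F>. finite \<F> \<and> \<F> \<subseteq> \<U> \<and> X closure_of S \<subseteq> \<Union> \<F>"
    using \<F> by (intro exI[of _ "\<F> - {topspace X - X closure_of S}"]) (auto simp: \<V>_def)
qed (rule closure_of_subset_topspace)

section \<open>Compactness of the diagonal operator\<close>

lemma tau_antimono:
  assumes "1 \<le> m" "m \<le> n"
  shows "tau n \<le> tau m"
proof -
  have "0 \<le> ln (real m)" "ln (real m) \<le> ln (real n)"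
    using assms by auto
  then show ?thesis
    unfolding tau_def by (intro divide_left_mono) auto
qed

lemma tau_tendsto_zero: "(\<lambda>n. tau (Suc n)) \<longlonglongrightarrow> 0"
  unfolding tau_def by real_asymp

lemma summable_seq_of_ell1: "summable (\<lambda>k. \<bar>seq_of_ell1 x k\<bar>)"
  using seq_of_ell1[of x] by simp

lemma sum_le_norm_ell1: "(\<Sum>k<n. \<bar>seq_of_ell1 x k\<bar>) \<le> norm x"
  unfolding norm_ell1.rep_eq by (rule sum_le_suminf) (auto simp: summable_seq_of_ell1)

lemma abs_seq_le_norm_ell1: "\<bar>seq_of_ell1 x k\<bar> \<le> norm x"
proof -
  have "\<bar>seq_of_ell1 x k\<bar> \<le> (\<Sum>i<Suc k. \<bar>seq_of_ell1 x i\<bar>)"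
    by (rule member_le_sum) simp_all
  then show ?thesis
    using sum_le_norm_ell1 order.trans by blast
qed

lemma norm_ell1_le:
  assumes "\<And>n. (\<Sum>k<n. \<bar>seq_of_ell1 x k\<bar>) \<le> B"
  shows "norm x \<le> B"
  unfolding norm_ell1.rep_eq by (rule suminf_le_const[OF summable_seq_of_ell1 assms])

lemma summable_abs_if_bounded:
  fixes f :: "nat \<Rightarrow> real"
  assumes "\<And>n. (\<Sum>k<n. \<bar>f k\<bar>) \<le> B"
  shows "summable (\<lambda>k. \<bar>f k\<bar>)"
  by (rule bounded_imp_summable[where B=B])
     (simp, unfold lessThan_Suc_atMost[symmetric], rule assms)

text \<open>Weights are at most 1 on the first \<open>N\<close> coordinates and at most
  \<open>tau (Suc N)\<close> afterwards. Finitely many coordinates thus control the image up to a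
  uniformly small error on balls.\<close>

lemma norm_D_t_le:
  "norm (D_t x) \<le> (\<Sum>k<N. \<bar>seq_of_ell1 x k\<bar>) + tau (Suc N) * norm x"
proof (rule norm_ell1_le)
  fix n
  let ?x = "seq_of_ell1 x"
  have "(\<Sum>k<n. \<bar>seq_of_ell1 (D_t x) k\<bar>)
      \<le> (\<Sum>k<n. (if k < N then \<bar>?x k\<bar> else 0) + tau (Suc N) * \<bar>?x k\<bar>)"
  proof (rule sum_mono)
    fix k
    show "\<bar>seq_of_ell1 (D_t x) k\<bar> \<le> (if k < N then \<bar>?x k\<bar> else 0) + tau (Suc N) * \<bar>?x k\<bar>"
      using tau_antimono[of "Suc N" "Suc k"] abs_tau_mult_le[of k "?x k"] tau_nonneg[of k]
        tau_nonneg[of N]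
      by (auto simp: D_t.rep_eq abs_mult add_increasing2 intro!: mult_right_mono)
  qed
  also have "\<dots> = (\<Sum>k<n. if k < N then \<bar>?x k\<bar> else 0) + tau (Suc N) * (\<Sum>k<n. \<bar>?x k\<bar>)"
    by (simp add: sum.distrib sum_distrib_left)
  also have "(\<Sum>k<n. if k < N then \<bar>?x k\<bar> else 0) = (\<Sum>k\<in>{..<n} \<inter> {..<N}. \<bar>?x k\<bar>)"
    by (simp add: sum.inter_restrict)
  also have "\<dots> \<le> (\<Sum>k<N. \<bar>?x k\<bar>)"
    by (rule sum_mono2) auto
  also have "tau (Suc N) * (\<Sum>k<n. \<bar>?x k\<bar>) \<le> tau (Suc N) * norm x"
    by (intro mult_left_mono sum_le_norm_ell1 tau_nonneg)
  finally show "(\<Sum>k<n. \<bar>seq_of_ell1 (D_t x) k\<bar>) \<le> (\<Sum>k<N. \<bar>?x k\<bar>) + tau (Suc N) * norm x"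
    by simp
qed

text \<open>Tychonoff's theorem. It serves three index sets: coordinates of $l_1$, functionals in
  the bidual, and basis vectors of a finite-dimensional space.\<close>

lemma compact_Pi:
  assumes "\<And>x. compact (K x)"
  shows "compact {f. \<forall>x. f x \<in> K x}"
proof -
  have "{f. \<forall>x. f x \<in> K x} = PiE UNIV K"
    by (auto simp: PiE_def Pi_def)
  then show ?thesis
    using assms compactin_PiE[of "\<lambda>_. euclidean" UNIV K]
    by (simp add: euclidean_product_topology)
qed

text \<open>On a ball of $l_1$, the operator $D_t$ is continuous from the topology of coordinatewise
  convergence to the norm topology.\<close>

lemma compact_D_t_cball: "compact (D_t ` cball 0 r)"
proof -
  \<comment> \<open>Partial sums describe the ball by conditions on finitely many coordinates each,
    which are closed under coordinatewise convergence.\<close>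
  define K :: "(nat \<Rightarrow> real) set" where "K = {f. \<forall>n. (\<Sum>k<n. \<bar>f k\<bar>) \<le> r}"
  have rep: "seq_of_ell1 (Abs_ell1 f) = f" if "f \<in> K" for f
    using that summable_abs_if_bounded[of f r] by (simp add: K_def Abs_ell1_inverse)
  have norm: "norm (Abs_ell1 f) \<le> r" if "f \<in> K" for f
    using that rep[OF that] by (intro norm_ell1_le) (auto simp: K_def)
  have "K = {f. \<forall>k. f k \<in> {-r..r}} \<inter> (\<Inter>n. {f. (\<Sum>k<n. \<bar>f k\<bar>) \<le> r})"
  proof (intro equalityI subsetI IntI)
    fix f assume f: "f \<in> K"
    have "\<bar>f k\<bar> \<le> r" for k
      using abs_seq_le_norm_ell1[of "Abs_ell1 f" k] rep[OF f] norm[OF f] by simp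
    then show "f \<in> {f. \<forall>k. f k \<in> {-r..r}}"
      by (auto simp: abs_le_iff minus_le_iff)
  qed (auto simp: K_def)
  moreover have "closed (\<Inter>n. {f :: nat \<Rightarrow> real. (\<Sum>k<n. \<bar>f k\<bar>) \<le> r})"
    by (intro closed_INT ballI closed_Collect_le continuous_intros continuous_on_product_coordinates)
  ultimately have "compact K"
    using compact_Pi[of "\<lambda>k::nat. {-r..r}"] by (simp add: compact_Int_closed)
  moreover have "continuous_on K (\<lambda>f. D_t (Abs_ell1 f))"
    unfolding continuous_on_def
  proof (intro ballI tendstoI)
    fix f and e :: real
    assume f: "f \<in> K" and e: "e > 0"
    \<comment> \<open>The number \<open>2 * r\<close> bounds the norm of the difference of two
      elements of the ball.\<close>
    have "(\<lambda>N. tau (Suc N) * (2 * r)) \<longlonglongrightarrow> 0 * (2 * r)"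
      by (intro tendsto_intros tau_tendsto_zero)
    then have "\<forall>\<^sub>F N in sequentially. tau (Suc N) * (2 * r) < e / 2"
      using e by (intro order_tendstoD) auto
    then obtain N where N: "tau (Suc N) * (2 * r) < e / 2"
      by (metis eventually_sequentially order_refl)
    have "((\<lambda>g. g k) \<longlongrightarrow> f k) (at f within K)" for k
      using continuous_on_subset[OF continuous_on_product_coordinates[of k] subset_UNIV] f
      unfolding continuous_on_def by blast
    then have "((\<lambda>g. \<Sum>k<N. \<bar>g k - f k\<bar>) \<longlongrightarrow> (\<Sum>k<N. \<bar>f k - f k\<bar>)) (at f within K)"
      by (intro tendsto_intros)
    then have "\<forall>\<^sub>F g in at f within K. (\<Sum>k<N. \<bar>g k - f k\<bar>) < e / 2"
      using e by (intro order_tendstoD) auto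
    moreover have "\<forall>\<^sub>F g in at f within K. g \<in> K"
      by (simp add: eventually_at_filter)
    ultimately show "\<forall>\<^sub>F g in at f within K. dist (D_t (Abs_ell1 g)) (D_t (Abs_ell1 f)) < e"
    proof eventually_elim
      case (elim g)
      let ?d = "Abs_ell1 g - Abs_ell1 f"
      have "dist (D_t (Abs_ell1 g)) (D_t (Abs_ell1 f)) = norm (D_t ?d)"
        by (simp add: dist_norm bounded_linear.linear[OF bounded_linear_D_t] linear_diff)
      also have "\<dots> \<le> (\<Sum>k<N. \<bar>seq_of_ell1 ?d k\<bar>) + tau (Suc N) * norm ?d"
        by (rule norm_D_t_le)
      also have "(\<Sum>k<N. \<bar>seq_of_ell1 ?d k\<bar>) = (\<Sum>k<N. \<bar>g k - f k\<bar>)"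
        using elim f by (simp add: minus_ell1.rep_eq rep)
      also have "tau (Suc N) * norm ?d \<le> tau (Suc N) * (2 * r)"
        using norm[OF f] norm[of g] elim norm_triangle_ineq4[of "Abs_ell1 g" "Abs_ell1 f"]
        by (intro mult_left_mono tau_nonneg) auto
      finally show ?case
        using elim N by linarith
    qed
  qed
  ultimately have "compact ((\<lambda>f. D_t (Abs_ell1 f)) ` K)"
    by (rule compact_continuous_image[rotated])
  also have "(\<lambda>f. D_t (Abs_ell1 f)) ` K = D_t ` cball 0 r"
  proof (intro equalityI image_subsetI)
    fix x :: ell1 assume "x \<in> cball 0 r"
    then have "seq_of_ell1 x \<in> K"
      using sum_le_norm_ell1[of x] by (auto simp: K_def intro: order.trans)
    then show "D_t x \<in> (\<lambda>f. D_t (Abs_ell1 f)) ` K"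
      by (metis (no_types, lifting) imageI seq_of_ell1_inverse)
  qed (use norm in auto)
  finally show ?thesis .
qed

section \<open>Ultrapower classes and the diagonal embedding\<close>

lemma bounded_families_const: "(\<lambda>i. c) \<in> bounded_families"
  by (simp add: bounded_families_def)

lemma bounded_families_add:
  assumes "x \<in> bounded_families" "y \<in> bounded_families"
  shows "(\<lambda>i. x i + y i) \<in> bounded_families"
  using assms unfolding bounded_families_def by (auto intro: bounded_plus_comp)

lemma bounded_families_bounded_linear:
  assumes "bounded_linear T" "x \<in> bounded_families"
  shows "(\<lambda>i. T (x i)) \<in> bounded_families"
  using bounded_linear_image[OF _ assms(1), of "range x"] assms(2)
  by (simp add: bounded_families_def image_image)

lemma equiv_ultra_rel: "equiv bounded_families (ultra_rel U)"
proof (rule equivI)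
  show "trans (ultra_rel U)"
  proof (rule transI)
    fix x y z
    assume xyz: "(x, y) \<in> ultra_rel U" "(y, z) \<in> ultra_rel U"
    then have "((\<lambda>i. norm (x i - y i) + norm (y i - z i)) \<longlongrightarrow> 0) U"
      by (auto simp: ultra_rel_def intro!: tendsto_add_zero)
    then have "((\<lambda>i. norm (x i - z i)) \<longlongrightarrow> 0) U"
      by (rule tendsto_0_le[where K=1])
        (auto intro!: always_eventually norm_diff_triangle_le)
    then show "(x, z) \<in> ultra_rel U"
      using xyz by (simp add: ultra_rel_def)
  qed
  show "sym (ultra_rel U)"
  proof (rule symI)
    fix x y
    assume "(x, y) \<in> ultra_rel U"
    moreover have "(\<lambda>i. norm (y i - x i)) = (\<lambda>i. norm (x i - y i))"
      by (intro ext norm_minus_commute)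
    ultimately show "(y, x) \<in> ultra_rel U"
      unfolding ultra_rel_def by simp
  qed
qed (auto simp: ultra_rel_def refl_on_def)

lemma congruent_bounded_linear:
  fixes T :: "'a::real_normed_vector \<Rightarrow> 'b::real_normed_vector"
  assumes T: "bounded_linear T"
  shows "congruent (ultra_rel U) (\<lambda>x. ultra_rel U `` {\<lambda>i. T (x i)})"
proof (rule congruentI, rule equiv_class_eq[OF equiv_ultra_rel])
  fix x y :: "'c \<Rightarrow> 'a"
  assume xy: "(x, y) \<in> ultra_rel U"
  then have "((\<lambda>i. x i - y i) \<longlongrightarrow> 0) U"
    by (simp add: ultra_rel_def tendsto_norm_zero_iff)
  then have "((\<lambda>i. T (x i - y i)) \<longlongrightarrow> 0) U"
    by (rule bounded_linear.tendsto_zero[OF T])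
  then show "(\<lambda>i. T (x i), \<lambda>i. T (y i)) \<in> ultra_rel U"
    using xy bounded_families_bounded_linear[OF T, of x] bounded_families_bounded_linear[OF T, of y]
    by (simp add: ultra_rel_def tendsto_norm_zero_iff linear_diff bounded_linear.linear[OF T])
qed

lemma congruent2_add:
  "congruent2 (ultra_rel U) (ultra_rel U) (\<lambda>x y. ultra_rel U `` {\<lambda>i. x i + y i :: 'a::real_normed_vector})"
proof (rule congruent2I', rule equiv_class_eq[OF equiv_ultra_rel])
  fix x x' y y' :: "'b \<Rightarrow> 'a"
  assume xy: "(x, x') \<in> ultra_rel U" "(y, y') \<in> ultra_rel U"
  then have "((\<lambda>i. (x i - x' i) + (y i - y' i)) \<longlongrightarrow> 0) U"
    by (intro tendsto_add_zero) (auto simp: ultra_rel_def tendsto_norm_zero_iff)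
  then show "(\<lambda>i. x i + y i, \<lambda>i. x' i + y' i) \<in> ultra_rel U"
    using xy bounded_families_add
    by (auto simp: ultra_rel_def tendsto_norm_zero_iff algebra_simps)
qed

lemma ultrapower_op_class:
  assumes "bounded_linear T" "x \<in> bounded_families"
  shows "ultrapower_op U T (ultra_rel U `` {x}) = ultra_rel U `` {\<lambda>i. T (x i)}"
  unfolding ultrapower_op_def
  by (rule UN_equiv_class[OF equiv_ultra_rel congruent_bounded_linear[OF assms(1)] assms(2)])

definition diag :: "'i filter \<Rightarrow> 'a::real_normed_vector \<Rightarrow> ('i \<Rightarrow> 'a) set" where
  "diag U y = ultra_rel U `` {\<lambda>i. y}"

lemma diag_closed: "diag U y \<in> carrier (ultrapower U)"
  using quotientI[OF bounded_families_const, of "ultra_rel U" y] by (simp add: diag_def ultrapower_def)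

lemma diag_add: "diag U (x + y) = diag U x \<oplus>\<^bsub>ultrapower U\<^esub> diag U y"
  using UN_equiv_class2[OF equiv_ultra_rel equiv_ultra_rel congruent2_add[of U]
      bounded_families_const[of x] bounded_families_const[of y]]
  unfolding diag_def ultrapower_def by simp

lemma diag_scale: "diag U (r *\<^sub>R x) = r \<odot>\<^bsub>ultrapower U\<^esub> diag U x"
  using UN_equiv_class[OF equiv_ultra_rel congruent_bounded_linear[OF bounded_linear_scaleR_right[of r]]
      bounded_families_const[of x], of U]
  unfolding diag_def ultrapower_def by simp

lemma sup_norm_nonneg:
  assumes "x \<in> bounded_families"
  shows "0 \<le> (SUP i. norm (x i))"
proof -
  have "bdd_above (range (\<lambda>i. norm (x i)))"
    using assms by (auto simp: bounded_families_def bounded_iff bdd_above_def)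
  then show ?thesis
    by (rule cSUP_upper2[OF _ UNIV_I]) simp
qed

lemma nrm_ultrapower:
  "nrm (ultrapower U) a = (INF x\<in>a. SUP i. norm (x i))"
  by (simp add: ultrapower_def)

lemma class_subset: "ultra_rel U `` {x} \<subseteq> bounded_families"
  by (auto simp: ultra_rel_def)

lemma bdd_below_sup_norm:
  "bdd_below ((\<lambda>x. SUP i. norm (x i)) ` (ultra_rel U `` {x}))"
  using class_subset sup_norm_nonneg by (intro bdd_belowI2[of _ 0]) blast

lemma in_diag: "(\<lambda>i. y) \<in> diag U y"
  unfolding diag_def by (rule equiv_class_self[OF equiv_ultra_rel bounded_families_const])

lemma nrm_diag_le: "nrm (ultrapower U) (diag U y) \<le> norm y"
  unfolding nrm_ultrapower
  using cINF_lower[OF bdd_below_sup_norm[of U "\<lambda>i. y"] in_diag[of y U, unfolded diag_def]]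
  by (simp add: diag_def)

lemma nrm_diag_nonneg: "0 \<le> nrm (ultrapower U) (diag U y)"
  unfolding nrm_ultrapower diag_def
  by (rule cINF_greatest)
    (use in_diag[of y U] class_subset sup_norm_nonneg in \<open>unfold diag_def, blast+\<close>)

text \<open>A functional on the ultrapower, composed with \<open>diag U\<close>, is bounded and
  linear, so preimages of subbasic weakly open sets are norm open. Norm compact sets therefore have
  weakly compact diagonal images.\<close>

lemma continuous_map_diag: "continuous_map euclidean (weak_topology (ultrapower U)) (diag U)"
  unfolding weak_topology_def
proof (rule continuous_on_generated_topo)
  fix S :: "('b \<Rightarrow> 'a) set set"
  assume "S \<in> {{x \<in> carrier (ultrapower U). f x \<in> V} | f V. f \<in> carrier (dual (ultrapower U)) \<and> open V}"
  then obtain f V where f: "f \<in> carrier (dual (ultrapower U))" and V: "open V"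
    and S: "S = {x \<in> carrier (ultrapower U). f x \<in> V}"
    by blast
  obtain K where K: "\<forall>x\<in>carrier (ultrapower U). \<bar>f x\<bar> \<le> K * nrm (ultrapower U) x"
    using f by (auto simp: dual_def bounded_operator_def nspace_of_def)
  have add: "\<And>x y. x \<in> carrier (ultrapower U) \<Longrightarrow> y \<in> carrier (ultrapower U) \<Longrightarrow>
      f (x \<oplus>\<^bsub>ultrapower U\<^esub> y) = f x + f y"
    and scale: "\<And>r x. x \<in> carrier (ultrapower U) \<Longrightarrow> f (r \<odot>\<^bsub>ultrapower U\<^esub> x) = r * f x"
    using f by (auto simp: dual_def bounded_operator_def nspace_of_def)
  \<comment> \<open>The constant in \<open>bounded_operator\<close> may be negative, hence the
    absolute value of \<open>K\<close>.\<close>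
  have "bounded_linear (\<lambda>y. f (diag U y))"
  proof (rule bounded_linear_intro[where K="\<bar>K\<bar>"])
    fix y
    have "\<bar>f (diag U y)\<bar> \<le> \<bar>K\<bar> * nrm (ultrapower U) (diag U y)"
      using bspec[OF K diag_closed[of U y]] nrm_diag_nonneg[of U y]
      by (meson abs_ge_self mult_right_mono order.trans)
    also have "\<dots> \<le> \<bar>K\<bar> * norm y"
      by (intro mult_left_mono nrm_diag_le) auto
    finally show "norm (f (diag U y)) \<le> norm y * \<bar>K\<bar>"
      by (simp add: mult.commute)
  qed (simp_all add: diag_add diag_scale add scale diag_closed)
  then have "open ((\<lambda>y. f (diag U y)) -` V)"
    by (intro open_vimage V linear_continuous_on)
  moreover have "diag U -` S \<inter> topspace euclidean = (\<lambda>y. f (diag U y)) -` V"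
    using S diag_closed by auto
  ultimately show "openin euclidean (diag U -` S \<inter> topspace euclidean)"
    by simp
next
  show "diag U ` topspace euclidean
    \<subseteq> \<Union> {{x \<in> carrier (ultrapower U). f x \<in> V} | f V. f \<in> carrier (dual (ultrapower U)) \<and> open V}"
    unfolding topspace_weak_topology[of "ultrapower U", unfolded weak_topology_def topology_generated_by_topspace]
    using diag_closed by (rule image_subsetI)
qed

text \<open>Compactness gives a cluster point. If the family were not eventually in some
  neighbourhood of it, an ultrafilter would put it eventually in the complement, contradicting
  clustering.\<close>

lemma ultrafilter_limit:
  assumes U: "ultrafilter U" and K: "compact K" and x: "\<And>i. x i \<in> K"
  obtains l where "l \<in> K" "(x \<longlongrightarrow> l) U"
proof -
  have "filtermap x U \<noteq> bot"
    using U by (simp add: ultrafilter_def filtermap_bot_iff)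
  moreover have "eventually (\<lambda>y. y \<in> K) (filtermap x U)"
    by (simp add: eventually_filtermap x)
  ultimately obtain l where l: "l \<in> K" "inf (nhds l) (filtermap x U) \<noteq> bot"
    using K unfolding compact_filter by blast
  have "(x \<longlongrightarrow> l) U"
  proof (rule topological_tendstoI, rule ccontr)
    fix S assume S: "open S" "l \<in> S" "\<not> (\<forall>\<^sub>F i in U. x i \<in> S)"
    then have "\<forall>\<^sub>F y in filtermap x U. y \<notin> S"
      using U by (auto simp: ultrafilter_def eventually_filtermap)
    moreover have "\<forall>\<^sub>F y in nhds l. y \<in> S"
      using S eventually_nhds by blast
    ultimately have "\<forall>\<^sub>F y in inf (nhds l) (filtermap x U). False"
      unfolding eventually_inf by blast
    then show False
      using l(2) by (simp add: eventually_False)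
  qed
  then show ?thesis
    using l(1) that by blast
qed

text \<open>The norm of a class is an infimum over representatives. A class of norm at most 1 is
  therefore lifted to a family of supremum norm below 2, which explains the radius. The images of
  that family have a limit along \<open>U\<close>, whose diagonal class is the image of the
  class.\<close>

lemma super_weakly_compactI:
  fixes T :: "'a::real_normed_vector \<Rightarrow> 'b::real_normed_vector"
  assumes T: "bounded_linear T" and K: "compact (T ` cball 0 2)"
  shows "super_weakly_compact TYPE('i) T"
  unfolding super_weakly_compact_def
proof (intro allI impI)
  fix U :: "'i filter"
  assume U: "ultrafilter U"
  have "ultrapower_op U T ` unit_ball (ultrapower U) \<subseteq> diag U ` T ` cball 0 2"
  proof (rule image_subsetI)
    fix a
    assume a: "a \<in> unit_ball (ultrapower U :: ('i \<Rightarrow> 'a) set nspace)"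
    then obtain z where z: "z \<in> bounded_families" "a = ultra_rel U `` {z}"
      by (auto simp: unit_ball_def ultrapower_def elim: quotientE)
    have ne: "a \<noteq> {}"
      using z equiv_class_self[OF equiv_ultra_rel, of z] by blast
    have "(INF x\<in>a. SUP i. norm (x i)) < 2"
      using a by (simp add: unit_ball_def nrm_ultrapower)
    then obtain x where x: "x \<in> a" "(SUP i. norm (x i)) < 2"
      using cInf_lessD[of "(\<lambda>x. SUP i. norm (x i)) ` a"] ne by auto
    then have xb: "x \<in> bounded_families" and ax: "a = ultra_rel U `` {x}"
      using z class_subset equiv_class_eq_iff[OF equiv_ultra_rel] by blast+
    have "bdd_above (range (\<lambda>i. norm (x i)))"
      using xb by (auto simp: bounded_families_def bounded_iff bdd_above_def)
    then have "norm (x i) \<le> 2" for i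
      using x(2) cSUP_upper[OF UNIV_I] by (metis less_imp_le order.trans)
    then have Tx: "T (x i) \<in> T ` cball 0 2" for i
      by simp
    then obtain l where l: "l \<in> T ` cball 0 2" "((\<lambda>i. T (x i)) \<longlongrightarrow> l) U"
      using ultrafilter_limit[OF U K, of "\<lambda>i. T (x i)"] by blast
    have "ultrapower_op U T a = diag U l"
      unfolding ax ultrapower_op_class[OF T xb] diag_def
      using l(2) bounded_families_bounded_linear[OF T xb] bounded_families_const[of l]
      by (intro equiv_class_eq[OF equiv_ultra_rel])
        (simp add: ultra_rel_def tendsto_norm_zero_iff LIM_zero)
    then show "ultrapower_op U T a \<in> diag U ` T ` cball 0 2"
      using l(1) by blast
  qed
  moreover have "compactin (weak_topology (ultrapower U)) (diag U ` T ` cball 0 2)"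
    using image_compactin[OF _ continuous_map_diag] K by simp
  ultimately show "weakly_compact (ultrapower U) (ultrapower U) (ultrapower_op U T)"
    unfolding weakly_compact_def
    by (intro compactin_closure_of_subset_compactin[OF regular_space_weak_topology])
qed

section \<open>Martingale type\<close>

lift_definition ell1_unit :: "nat \<Rightarrow> ell1" is "\<lambda>i k. if k = i then 1 else 0"
  by (rule summable_finite[of "{i}" for i]) auto

lemma seq_of_ell1_sum: "seq_of_ell1 (\<Sum>i\<in>A. f i) k = (\<Sum>i\<in>A. seq_of_ell1 (f i) k)"
  by (induction A rule: infinite_finite_induct) (simp_all add: zero_ell1.rep_eq plus_ell1.rep_eq)

lemma seq_of_ell1_unit_sum:
  "seq_of_ell1 (\<Sum>i<n. c i *\<^sub>R ell1_unit i) k = (if k < n then c k else 0)"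
  by (simp add: seq_of_ell1_sum scaleR_ell1.rep_eq ell1_unit.rep_eq if_distrib sum.delta cong: if_cong)

lemma norm_unit_sum: "norm (\<Sum>i<n. c i *\<^sub>R ell1_unit i) = (\<Sum>i<n. \<bar>c i\<bar>)"
  unfolding norm_ell1.rep_eq seq_of_ell1_unit_sum
  by (subst suminf_finite[of "{..<n}"]) auto

lemma norm_ell1_unit: "norm (ell1_unit i) = 1"
  using norm_unit_sum[of "\<lambda>j. if j = i then 1 else 0" "Suc i"]
  by (simp add: if_distrib if_distribR sum.delta cong: if_cong)

lemma D_t_unit: "D_t (ell1_unit i) = tau (Suc i) *\<^sub>R ell1_unit i"
  by transfer auto

text \<open>Comparing every term with the largest one gives a crude constant for all positive
  \<open>p\<close>. It serves only to show that some Haar type bound exists.\<close>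

lemma sum_powr_le:
  fixes a :: "'i \<Rightarrow> real"
  assumes A: "finite A" and a: "\<And>k. k \<in> A \<Longrightarrow> 0 \<le> a k" and p: "0 < p"
  shows "(\<Sum>k\<in>A. a k) powr p \<le> real (card A) powr p * (\<Sum>k\<in>A. a k powr p)"
proof (cases "A = {}")
  case False
  define M where "M = Max (a ` A)"
  have "M \<in> a ` A"
    unfolding M_def using A False by (intro Max_in) auto
  then obtain m where m: "m \<in> A" "a m = M"
    by auto
  have "(\<Sum>k\<in>A. a k) \<le> real (card A) * M"
    unfolding M_def using A by (intro sum_bounded_above Max_ge) auto
  then have "(\<Sum>k\<in>A. a k) powr p \<le> (real (card A) * M) powr p"
    using a p by (intro powr_mono2 sum_nonneg) auto
  also have "\<dots> = real (card A) powr p * a m powr p"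
    using m a[of m] by (simp add: powr_mult)
  also have "\<dots> \<le> real (card A) powr p * (\<Sum>k\<in>A. a k powr p)"
    using A m(1) by (intro mult_left_mono member_le_sum) auto
  finally show ?thesis .
qed simp

section \<open>Integrability of Haar sums and existence of a type bound\<close>

lemma dyadic_measurable [measurable]: "dyadic k j \<in> sets borel"
  by (simp add: dyadic_def)

lemma simple_function_haar: "simple_function lborel (haar k j)"
proof -
  \<comment> \<open>The set difference mirrors the order of the case distinction in
    \<open>haar\<close>. For \<open>j = 0\<close>, truncated subtraction makes both intervals
    equal.\<close>
  have *: "haar k j = (\<lambda>t. indicator (dyadic k (2 * j - 1)) t * 2 powr ((real k - 1) / 2)
      - indicator (dyadic k (2 * j) - dyadic k (2 * j - 1)) t * 2 powr ((real k - 1) / 2))"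
    by (auto simp: haar_def fun_eq_iff)
  show ?thesis
    unfolding * by (intro simple_function_diff simple_function_mult simple_function_indicator simple_function_const) auto
qed

text \<open>A Haar sum has finitely many values. This yields measurability and boundedness for
  values in any normed space, separable or not.\<close>

lemma set_integrable_haar_sum:
  "set_integrable lborel {0..<1} (\<lambda>t. norm (\<Sum>j\<in>A. haar k j t *\<^sub>R x j) powr p)"
proof -
  have "simple_function lborel (\<lambda>t. haar k j t *\<^sub>R x j)" for j
    by (rule simple_function_compose1[OF simple_function_haar, where g="\<lambda>r. r *\<^sub>R x j"])
  then have "simple_function lborel (\<lambda>t. \<Sum>j\<in>A. haar k j t *\<^sub>R x j)"
    by (rule simple_function_sum)
  then have sf: "simple_function lborel (\<lambda>t. norm (\<Sum>j\<in>A. haar k j t *\<^sub>R x j) powr p)"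
    by (rule simple_function_compose1[where g="\<lambda>v. norm v powr p"])
  then have "finite (range (\<lambda>t. norm (\<Sum>j\<in>A. haar k j t *\<^sub>R x j) powr p))"
    by (auto dest: simple_functionD(1))
  then obtain B where "\<And>t. norm (norm (\<Sum>j\<in>A. haar k j t *\<^sub>R x j) powr p) \<le> B"
    by (meson finite_imp_bounded bounded_iff rangeI)
  then show ?thesis
    unfolding set_integrable_def
    by (intro integrableI_bounded_set_indicator[where B=B])
      (use borel_measurable_simple_function[OF sf] in auto)
qed

lemma haar_index_eq: "haar_index n = Sigma {1..n} (\<lambda>k. {1..2 ^ (k - 1)})"
  by (auto simp: haar_index_def)

text \<open>The triangle inequality over the \<open>n\<close> levels gives a crude admissible
  constant. It makes the set in \<open>haar_type_norm\<close> nonempty, so that a lower bound of the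
  set is one of its infimum.\<close>

lemma haar_type_bound_bounded_linear:
  assumes T: "bounded_linear T" and K: "0 \<le> K" "\<And>x. norm (T x) \<le> norm x * K" and p: "0 < p"
  shows "haar_type_bound p n T (K * real n)"
  unfolding haar_type_bound_def
proof
  fix x :: "nat \<Rightarrow> nat \<Rightarrow> 'a"
  define d where "d k t = (\<Sum>j = 1..2 ^ (k - 1). haar k j t *\<^sub>R x k j)" for k t
  define f where "f t = (\<Sum>(k, j)\<in>haar_index n. haar k j t *\<^sub>R T (x k j))" for t
  define I where "I k = (LINT t:{0..<1}|lborel. norm (d k t) powr p)" for k
  have I: "0 \<le> I k" for k
    unfolding I_def set_lebesgue_integral_def by (intro integral_nonneg_AE) auto
  have int: "set_integrable lborel {0..<1} (\<lambda>t. norm (d k t) powr p)" for k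
    unfolding d_def by (rule set_integrable_haar_sum)
  have f_eq: "f t = (\<Sum>k = 1..n. T (d k t))" for t
    unfolding f_def d_def haar_index_eq
    by (simp add: sum.Sigma linear_sum[OF bounded_linear.linear[OF T]]
        linear_scale[OF bounded_linear.linear[OF T]])
  have le: "norm (f t) powr p \<le> (K * real n) powr p * (\<Sum>k = 1..n. norm (d k t) powr p)" for t
  proof -
    have "norm (f t) \<le> (\<Sum>k = 1..n. norm (d k t) * K)"
      unfolding f_eq by (rule sum_norm_le) (rule K(2))
    then have "norm (f t) powr p \<le> (K * (\<Sum>k = 1..n. norm (d k t))) powr p"
      using p by (intro powr_mono2) (auto simp: sum_distrib_left mult.commute)
    also have "\<dots> \<le> K powr p * (real n powr p * (\<Sum>k = 1..n. norm (d k t) powr p))"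
      using sum_powr_le[of "{1..n}" "\<lambda>k. norm (d k t)" p] p K(1)
      by (simp add: powr_mult sum_nonneg mult_left_mono)
    finally show ?thesis
      using K(1) by (simp add: powr_mult mult.assoc)
  qed
  have ind: "indicat_real {0..<1} t *\<^sub>R ((K * real n) powr p * (\<Sum>k = 1..n. norm (d k t) powr p))
      = (K * real n) powr p * (\<Sum>k = 1..n. indicat_real {0..<1} t *\<^sub>R (norm (d k t) powr p))" for t
    by (simp add: sum_distrib_left mult_ac)
  \<comment> \<open>Integrability is checked for the majorant only: a nonintegrable left side would
    have the default integral 0, and the majorant is nonnegative.\<close>
  have "(LINT t:{0..<1}|lborel. norm (f t) powr p)
      \<le> (LINT t:{0..<1}|lborel. (K * real n) powr p * (\<Sum>k = 1..n. norm (d k t) powr p))"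
    unfolding set_lebesgue_integral_def
  proof (rule integral_mono')
    show "integrable lborel (\<lambda>t. indicat_real {0..<1} t *\<^sub>R ((K * real n) powr p * (\<Sum>k = 1..n. norm (d k t) powr p)))"
      unfolding ind
      by (intro integrable_mult_right Bochner_Integration.integrable_sum int[unfolded set_integrable_def])
  qed (use le in \<open>auto simp: indicator_def intro!: mult_nonneg_nonneg sum_nonneg\<close>)
  also have "\<dots> = (K * real n) powr p * (\<Sum>k = 1..n. I k)"
    unfolding set_lebesgue_integral_def ind I_def integral_mult_right_zero
    by (subst Bochner_Integration.integral_sum[OF int[unfolded set_integrable_def]]) simp
  finally have "Lp_norm p f \<le> ((K * real n) powr p * (\<Sum>k = 1..n. I k)) powr (1 / p)"
    unfolding Lp_norm_def using p
    by (intro powr_mono2) (auto simp: set_lebesgue_integral_def intro!: integral_nonneg_AE)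
  also have "\<dots> = K * real n * (\<Sum>k = 1..n. I k) powr (1 / p)"
    using K(1) I p by (simp add: powr_mult powr_powr sum_nonneg)
  also have "(\<Sum>k = 1..n. I k) = (\<Sum>k = 1..n. Lp_norm p (d k) powr p)"
    using I p by (simp add: Lp_norm_def powr_powr flip: I_def)
  finally show "Lp_norm p (\<lambda>t. \<Sum>(k, j)\<in>haar_index n. haar k j t *\<^sub>R T (x k j))
      \<le> K * real n * (\<Sum>k = 1..n. Lp_norm p (\<lambda>t. \<Sum>j = 1..2 ^ (k - 1). haar k j t *\<^sub>R x k j) powr p) powr (1 / p)"
    unfolding f_def d_def .
qed

lemma Lp_norm_const_norm:
  assumes "\<And>t. t \<in> {0..<1} \<Longrightarrow> norm (f t) = c" "0 < p"
  shows "Lp_norm p f = c"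
proof -
  have "0 \<le> c"
    using assms(1)[of 0] by auto
  have "(LINT t:{0..<1}|lborel. norm (f t) powr p) = (LINT t:{0..<1::real}|lborel. c powr p)"
    by (intro set_lebesgue_integral_cong) (auto simp: assms(1))
  also have "\<dots> = c powr p"
    by (simp add: set_lebesgue_integral_def)
  finally show ?thesis
    using assms(2) \<open>0 \<le> c\<close> by (simp add: Lp_norm_def powr_powr)
qed

section \<open>Rademacher functions and the lower bound for the type norms\<close>

lemma dyadic_iff_floor:
  assumes "1 \<le> j" "0 \<le> t"
  shows "t \<in> dyadic k j \<longleftrightarrow> j = nat \<lfloor>t * 2 ^ k\<rfloor> + 1"
proof -
  have "t \<in> dyadic k j \<longleftrightarrow> real j - 1 \<le> t * 2 ^ k \<and> t * 2 ^ k < real j"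
    by (simp add: dyadic_def field_simps)
  also have "\<dots> \<longleftrightarrow> \<lfloor>t * 2 ^ k\<rfloor> = int j - 1"
    by (simp add: floor_eq_iff)
  also have "\<dots> \<longleftrightarrow> j = nat \<lfloor>t * 2 ^ k\<rfloor> + 1"
  proof -
    have "0 \<le> \<lfloor>t * 2 ^ k\<rfloor>"
      using assms(2) by simp
    then show ?thesis
      using assms(1) by linarith
  qed
  finally show ?thesis .
qed

text \<open>The two halves of level \<open>k\<close> form one interval of level
  \<open>k - 1\<close>, on which the modulus is constant.\<close>

lemma abs_haar:
  assumes "1 \<le> k" "1 \<le> j"
  shows "\<bar>haar k j t\<bar> = (if t \<in> dyadic (k - 1) j then 2 powr ((real k - 1) / 2) else 0)"
proof -
  obtain m where k: "k = Suc m"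
    using assms(1) by (cases k) auto
  have "t \<in> dyadic k (2 * j - 1) \<or> t \<in> dyadic k (2 * j) \<longleftrightarrow> t \<in> dyadic (k - 1) j"
    using assms(2) by (auto simp: dyadic_def k field_simps of_nat_diff)
  then show ?thesis
    by (auto simp: haar_def)
qed

definition rademacher :: "nat \<Rightarrow> real \<Rightarrow> real" where
  "rademacher k t = (\<Sum>j = 1..2 ^ (k - 1). haar k j t / 2 powr ((real k - 1) / 2))"

text \<open>The supports of the Haar functions of one level tile [0,1). At \<open>t\<close> a single
  summand survives, and its modulus is the height that is divided out.\<close>

lemma abs_rademacher:
  assumes k: "1 \<le> k" and t: "t \<in> {0..<1}"
  shows "\<bar>rademacher k t\<bar> = 1"
proof -
  define i where "i = nat \<lfloor>t * 2 ^ (k - 1)\<rfloor> + 1"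
  have "t * 2 ^ (k - 1) < 2 ^ (k - 1)"
    using t by simp
  then have "\<lfloor>t * 2 ^ (k - 1)\<rfloor> < 2 ^ (k - 1)"
    by (simp add: floor_less_iff)
  then have "nat \<lfloor>t * 2 ^ (k - 1)\<rfloor> < 2 ^ (k - 1)"
    using t by (simp add: nat_less_iff)
  then have i: "i \<in> {1..2 ^ (k - 1)}"
    unfolding i_def atLeastAtMost_iff by linarith
  have "rademacher k t = (\<Sum>j\<in>{i}. haar k j t / 2 powr ((real k - 1) / 2))"
    unfolding rademacher_def
  proof (rule sum.mono_neutral_right)
    show "\<forall>j\<in>{1..2 ^ (k - 1)} - {i}. haar k j t / 2 powr ((real k - 1) / 2) = 0"
    proof
      fix j assume j: "j \<in> {1..2 ^ (k - 1)} - {i}"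
      then have "t \<notin> dyadic (k - 1) j"
        using t dyadic_iff_floor[of j t "k - 1"] by (auto simp: i_def)
      then show "haar k j t / 2 powr ((real k - 1) / 2) = 0"
        using abs_haar[OF k, of j t] j by simp
    qed
  qed (use i in auto)
  moreover have "t \<in> dyadic (k - 1) i"
    using t i dyadic_iff_floor[of i t "k - 1"] by (simp add: i_def)
  ultimately show ?thesis
    using abs_haar[OF k, of i t] i by (simp add: abs_divide)
qed

lemma tau_sum_le:
  assumes bound: "haar_type_bound p n D_t c" and p: "0 < p"
  shows "(\<Sum>i<n. tau (Suc i)) \<le> c * real n powr (1 / p)"
proof -
  \<comment> \<open>All coefficients of level \<open>k\<close> are the same multiple of $e_k$,
    stored at position \<open>k - 1\<close>; the factor cancels the height of the Haar
    functions.\<close>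
  define x where "x k j = (1 / 2 powr ((real k - 1) / 2)) *\<^sub>R ell1_unit (k - 1)" for k j :: nat
  have d: "(\<Sum>j = 1..2 ^ (k - 1). haar k j t *\<^sub>R x k j) = rademacher k t *\<^sub>R ell1_unit (k - 1)" for k t
    by (simp add: x_def rademacher_def scaleR_left.sum)
  have "Lp_norm p (\<lambda>t. \<Sum>j = 1..2 ^ (k - 1). haar k j t *\<^sub>R x k j) = 1" if "k \<in> {1..n}" for k
  proof (rule Lp_norm_const_norm[OF _ p])
    fix t :: real assume "t \<in> {0..<1}"
    then show "norm (\<Sum>j = 1..2 ^ (k - 1). haar k j t *\<^sub>R x k j) = 1"
      using abs_rademacher[of k t] that by (simp only: d norm_scaleR norm_ell1_unit) simp
  qed
  moreover have "Lp_norm p (\<lambda>t. \<Sum>(k, j)\<in>haar_index n. haar k j t *\<^sub>R D_t (x k j)) = (\<Sum>i<n. tau (Suc i))"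
  proof (rule Lp_norm_const_norm[OF _ p])
    fix t :: real assume t: "t \<in> {0..<1}"
    interpret D: linear D_t
      by (rule bounded_linear.linear[OF bounded_linear_D_t])
    have "(\<Sum>(k, j)\<in>haar_index n. haar k j t *\<^sub>R D_t (x k j))
        = (\<Sum>k = 1..n. D_t (\<Sum>j = 1..2 ^ (k - 1). haar k j t *\<^sub>R x k j))"
      by (simp add: haar_index_eq sum.Sigma D.sum D.scale)
    also have "\<dots> = (\<Sum>k = 1..n. (rademacher k t * tau k) *\<^sub>R ell1_unit (k - 1))"
      unfolding d by (intro sum.cong refl) (simp add: D.scale D_t_unit)
    also have "\<dots> = (\<Sum>i<n. (rademacher (Suc i) t * tau (Suc i)) *\<^sub>R ell1_unit i)"
      by (rule sum.reindex_bij_witness[of _ Suc "\<lambda>k. k - 1"]) auto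
    finally show "norm (\<Sum>(k, j)\<in>haar_index n. haar k j t *\<^sub>R D_t (x k j)) = (\<Sum>i<n. tau (Suc i))"
      using abs_rademacher[OF _ t] by (simp add: norm_unit_sum abs_mult tau_nonneg)
  qed
  ultimately show ?thesis
    using bound[unfolded haar_type_bound_def, rule_format, of x] by simp
qed

lemma haar_type_norm_D_t_ge:
  assumes p: "0 < p" and n: "1 \<le> n"
  shows "real n * tau n / real n powr (1 / p) \<le> haar_type_norm p n D_t"
  unfolding haar_type_norm_def
proof (rule cInf_greatest)
  obtain K where "0 \<le> K" "\<And>x. norm (D_t x) \<le> norm x * K"
    using bounded_linear.nonneg_bounded[OF bounded_linear_D_t] by auto
  then have "haar_type_bound p n D_t (K * real n)" "0 \<le> K * real n"
    using haar_type_bound_bounded_linear[OF bounded_linear_D_t _ _ p] by auto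
  then show "{c. 0 \<le> c \<and> haar_type_bound p n D_t c} \<noteq> {}"
    by blast
next
  fix c
  assume "c \<in> {c. 0 \<le> c \<and> haar_type_bound p n D_t c}"
  then have "(\<Sum>i<n. tau (Suc i)) \<le> c * real n powr (1 / p)"
    using tau_sum_le[OF _ p] by blast
  moreover have "(\<Sum>i<n. tau n) \<le> (\<Sum>i<n. tau (Suc i))"
    by (intro sum_mono tau_antimono) auto
  ultimately show "real n * tau n / real n powr (1 / p) \<le> c"
    using n by (simp add: divide_le_eq)
qed

lemma not_martingale_type_D_t:
  assumes p: "1 < p"
  shows "\<not> martingale_type p D_t"
proof
  assume "martingale_type p D_t"
  then obtain M where M: "\<And>n. \<bar>haar_type_norm p n D_t\<bar> \<le> M"
    unfolding martingale_type_def bounded_iff by auto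
  \<comment> \<open>The quotient equals n^(1 - 1/p) / (1 + log n), and 1 - 1/p is positive.\<close>
  have "filterlim (\<lambda>n. real n * tau n / real n powr (1 / p)) at_top sequentially"
    unfolding tau_def using p by real_asymp
  then have "\<forall>\<^sub>F n in sequentially. M + 1 \<le> real n * tau n / real n powr (1 / p)"
    by (simp add: filterlim_at_top)
  then have "\<forall>\<^sub>F n in sequentially. False"
    using eventually_ge_at_top[of 1]
  proof eventually_elim
    case (elim n)
    then show False
      using haar_type_norm_D_t_ge[of p n] M[of n] p by linarith
  qed
  then show False
    by simp
qed

section \<open>Factorization\<close>

text \<open>The bound on the \<open>z i\<close> gives the upper $l_1$ estimate by the triangle
  inequality. For positive \<open>c\<close> the vectors thus span a copy of $l_1^n$ with distortion
  at most 1/c.\<close>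

definition contains_l1 :: "'z::real_normed_vector itself \<Rightarrow> nat \<Rightarrow> real \<Rightarrow> bool" where
  "contains_l1 _ n c \<longleftrightarrow>
     (\<exists>z :: nat \<Rightarrow> 'z. (\<forall>i<n. norm (z i) \<le> 1) \<and>
        (\<forall>a. c * (\<Sum>i<n. \<bar>a i\<bar>) \<le> norm (\<Sum>i<n. a i *\<^sub>R z i)))"

lemma contains_l1_mono:
  assumes "contains_l1 TYPE('z::real_normed_vector) n c" "c' \<le> c"
  shows "contains_l1 TYPE('z) n c'"
proof -
  have "c' * (\<Sum>i<n. \<bar>a i\<bar>) \<le> c * (\<Sum>i<n. \<bar>a i\<bar>)" for a :: "nat \<Rightarrow> real"
    using assms(2) by (intro mult_right_mono sum_nonneg) auto
  then show ?thesis
    using assms(1) unfolding contains_l1_def by (meson order.trans)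
qed

lemma sum_lessThan_mult:
  fixes f :: "nat \<Rightarrow> 'a::comm_monoid_add"
  shows "(\<Sum>k<m * l. f k) = (\<Sum>q<m. \<Sum>i<l. f (q * l + i))"
proof -
  have "(\<Sum>k = q * l..<q * l + l. f k) = (\<Sum>i<l. f (q * l + i))" for q
    by (rule sum.reindex_bij_witness[of _ "\<lambda>i. q * l + i" "\<lambda>k. k - q * l"]) auto
  then show ?thesis
    by (simp flip: sum.nat_group)
qed

text \<open>James' blocking argument: unless one of the \<open>m\<close> blocks of length \<open>l\<close> satisfies the lower estimate
  with \<open>\<beta>\<close>, every block spans a vector with coefficients of $l_1$-norm 1 and norm below \<open>\<beta>\<close>; these
  \<open>m\<close> vectors, divided by \<open>\<beta>\<close>, satisfy it with \<open>\<alpha>\<close>.\<close>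

lemma contains_l1_mult:
  assumes "contains_l1 TYPE('z::real_normed_vector) (m * l) (\<alpha> * \<beta>)" and \<beta>: "0 < \<beta>"
  shows "contains_l1 TYPE('z) l \<beta> \<or> contains_l1 TYPE('z) m \<alpha>"
proof (rule disjCI)
  assume no: "\<not> contains_l1 TYPE('z) m \<alpha>"
  obtain z :: "nat \<Rightarrow> 'z" where z: "\<And>i. i < m * l \<Longrightarrow> norm (z i) \<le> 1"
    and low: "\<And>a. \<alpha> * \<beta> * (\<Sum>i<m * l. \<bar>a i\<bar>) \<le> norm (\<Sum>i<m * l. a i *\<^sub>R z i)"
    using assms(1) unfolding contains_l1_def by blast
  define w where "w q a = (\<Sum>i<l. a i *\<^sub>R z (q * l + i))" for q a
  define s where "s a = (\<Sum>i<l. \<bar>a i\<bar>)" for a :: "nat \<Rightarrow> real"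
  have "\<exists>q<m. \<forall>a. \<beta> * s a \<le> norm (w q a)"
  proof (rule ccontr)
    assume "\<not> (\<exists>q<m. \<forall>a. \<beta> * s a \<le> norm (w q a))"
    then have "\<forall>q. \<exists>a. q < m \<longrightarrow> norm (w q a) < \<beta> * s a"
      by (auto simp: not_le)
    then obtain a where a: "\<And>q. q < m \<Longrightarrow> norm (w q (a q)) < \<beta> * s (a q)"
      by metis
    \<comment> \<open>The strict inequality forces positivity, so the block vectors can be
      normalized.\<close>
    have s: "0 < \<beta> * s (a q)" if "q < m" for q
      using a[OF that] norm_ge_zero le_less_trans by blast
    define y where "y q = (1 / (\<beta> * s (a q))) *\<^sub>R w q (a q)" for q
    have "norm (y q) \<le> 1" if "q < m" for q
      using a[OF that] s[OF that] by (simp add: y_def divide_le_eq)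
    moreover have "\<alpha> * (\<Sum>q<m. \<bar>c q\<bar>) \<le> norm (\<Sum>q<m. c q *\<^sub>R y q)" for c
    proof -
      \<comment> \<open>These are the coefficients of the \<open>z k\<close> in the combination of
        the \<open>y q\<close>. Their absolute values in block \<open>q\<close> add up to |c q| /
        \<beta>, which cancels the factor \<beta> in the lower estimate \<open>low\<close>.\<close>
      define A where "A k = c (k div l) / (\<beta> * s (a (k div l))) * a (k div l) (k mod l)" for k
      have A: "A (q * l + i) = c q / (\<beta> * s (a q)) * a q i" if "i < l" for q i
        using that by (simp add: A_def)
      have "(\<Sum>k<m * l. A k *\<^sub>R z k) = (\<Sum>q<m. c q *\<^sub>R y q)"
        unfolding sum_lessThan_mult y_def w_def scaleR_sum_right
        by (intro sum.cong refl) (simp add: A)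
      moreover have "\<beta> * (\<Sum>k<m * l. \<bar>A k\<bar>) = (\<Sum>q<m. \<bar>c q\<bar>)"
        unfolding sum_lessThan_mult sum_distrib_left
      proof (intro sum.cong refl)
        fix q assume "q \<in> {..<m}"
        then have q: "0 < \<beta> * s (a q)"
          using s by simp
        have "(\<Sum>i<l. \<beta> * \<bar>A (q * l + i)\<bar>) = (\<Sum>i<l. (\<bar>c q\<bar> / s (a q)) * \<bar>a q i\<bar>)"
          using q \<beta> by (intro sum.cong refl) (simp add: A abs_mult zero_less_mult_iff)
        also have "\<dots> = (\<bar>c q\<bar> / s (a q)) * s (a q)"
          by (simp add: s_def sum_distrib_left)
        finally show "(\<Sum>i<l. \<beta> * \<bar>A (q * l + i)\<bar>) = \<bar>c q\<bar>"
          using q by auto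
      qed
      ultimately show ?thesis
        using low[of A] by (simp add: mult.assoc)
    qed
    ultimately show False
      using no unfolding contains_l1_def by blast
  qed
  then obtain q where q: "q < m" "\<And>a. \<beta> * s a \<le> norm (w q a)"
    by blast
  have "q * l + i < m * l" if "i < l" for i
  proof -
    have "q * l + i < Suc q * l"
      using that by simp
    also have "\<dots> \<le> m * l"
      using q(1) by (intro mult_right_mono) auto
    finally show ?thesis .
  qed
  then show "contains_l1 TYPE('z) l \<beta>"
    unfolding contains_l1_def using q(2) z
    by (intro exI[of _ "\<lambda>i. z (q * l + i)"]) (simp add: w_def s_def)
qed

text \<open>The vectors are cut into \<open>m\<close> blocks of length \<open>m ^ Suc j\<close>.
  Either a block inherits the estimate with \<open>\<beta> ^ Suc j\<close>, to which induction
  applies, or the block vectors already give the claim.\<close>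

lemma contains_l1_power:
  assumes "contains_l1 TYPE('z::real_normed_vector) (m ^ Suc j) (\<beta> ^ Suc j)" "0 < \<beta>"
  shows "contains_l1 TYPE('z) m \<beta>"
  using assms(1)
proof (induction j)
  case (Suc j)
  have "contains_l1 TYPE('z) (m ^ Suc j) (\<beta> ^ Suc j) \<or> contains_l1 TYPE('z) m \<beta>"
    using Suc.prems assms(2) by (intro contains_l1_mult) simp_all
  then show ?case
    using Suc.IH by blast
qed simp

text \<open>With L = log n, the hypothesis at n^j has the constant \<kappa> / (1 + j L). This
  exceeds \<beta>^j for large j, and then the power lemma descends to dimension n.\<close>

lemma contains_l1_if_logarithmic:
  assumes \<kappa>: "0 < \<kappa>" and tau: "\<And>n. 1 \<le> n \<Longrightarrow> contains_l1 TYPE('z::real_normed_vector) n (\<kappa> * tau n)"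
    and \<beta>: "0 < \<beta>" "\<beta> < 1"
  shows "contains_l1 TYPE('z) n \<beta>"
proof (cases "n = 0")
  case False
  define L where "L = ln (real n)"
  have L: "0 \<le> L"
    using False by (simp add: L_def)
  have "(\<lambda>k. \<beta> ^ k + L * (real k * \<beta> ^ k)) \<longlonglongrightarrow> 0 + L * 0"
    using \<beta> powser_times_n_limit_0[of \<beta>]
    by (intro tendsto_add tendsto_mult tendsto_const LIMSEQ_power_zero) auto
  then have "\<forall>\<^sub>F k in sequentially. \<beta> ^ k + L * (real k * \<beta> ^ k) < \<kappa>"
    using \<kappa> by (intro order_tendstoD) auto
  then obtain j where "\<beta> ^ Suc j + L * (real (Suc j) * \<beta> ^ Suc j) < \<kappa>"
    unfolding eventually_sequentially by (meson le_SucI order_refl)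
  then have "\<beta> ^ Suc j * (1 + real (Suc j) * L) \<le> \<kappa>"
    by (simp add: algebra_simps)
  moreover have "0 < 1 + real (Suc j) * L"
    using L by (simp add: add_pos_nonneg)
  ultimately have "\<beta> ^ Suc j \<le> \<kappa> / (1 + real (Suc j) * L)"
    by (simp only: pos_le_divide_eq)
  also have "\<dots> = \<kappa> * tau (n ^ Suc j)"
    using False by (simp add: tau_def L_def ln_realpow del: power_Suc)
  finally have "\<beta> ^ Suc j \<le> \<kappa> * tau (n ^ Suc j)" .
  moreover have "1 \<le> n ^ Suc j"
    using False by simp
  ultimately have "contains_l1 TYPE('z) (n ^ Suc j) (\<beta> ^ Suc j)"
    using contains_l1_mono tau by blast
  then show ?thesis
    using contains_l1_power \<beta>(1) by blast
qed (simp add: contains_l1_def)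

text \<open>The vectors $A e_i$, scaled into the unit ball, work: applying \<open>B\<close> recovers
  \<open>D_t\<close>, whose weights on the first \<open>n\<close> unit vectors are at least
  \<open>tau n\<close>. Bounds a and b for the two factors give \<kappa> = 1/(ab).\<close>

lemma factors_through_contains_l1:
  assumes "factors_through TYPE('z::real_normed_vector) D_t"
  obtains \<kappa> where "0 < \<kappa>" "\<And>n. 1 \<le> n \<Longrightarrow> contains_l1 TYPE('z) n (\<kappa> * tau n)"
proof -
  obtain A :: "ell1 \<Rightarrow> 'z" and B :: "'z \<Rightarrow> ell1" where A: "bounded_linear A" and B: "bounded_linear B"
    and AB: "\<And>x. D_t x = B (A x)"
    using assms unfolding factors_through_def by (metis comp_apply)
  interpret A: linear A by (rule bounded_linear.linear[OF A])
  obtain a where a: "0 < a" "\<And>x. norm (A x) \<le> norm x * a"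
    using bounded_linear.pos_bounded[OF A] by blast
  obtain b where b: "0 < b" "\<And>x. norm (B x) \<le> norm x * b"
    using bounded_linear.pos_bounded[OF B] by blast
  have "contains_l1 TYPE('z) n (1 / (a * b) * tau n)" if n: "1 \<le> n" for n
    unfolding contains_l1_def
  proof (intro exI conjI allI impI)
    fix i
    show "norm (A (ell1_unit i) /\<^sub>R a) \<le> 1"
      using a(1) a(2)[of "ell1_unit i"] by (simp add: field_simps norm_ell1_unit)
  next
    fix c :: "nat \<Rightarrow> real"
    let ?x = "\<Sum>i<n. c i *\<^sub>R ell1_unit i"
    have "tau n * (\<Sum>i<n. \<bar>c i\<bar>) \<le> (\<Sum>i<n. \<bar>c i * tau (Suc i)\<bar>)"
      unfolding sum_distrib_left
    proof (rule sum_mono)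
      fix i assume "i \<in> {..<n}"
      then have "tau n * \<bar>c i\<bar> \<le> tau (Suc i) * \<bar>c i\<bar>"
        by (intro mult_right_mono tau_antimono) auto
      then show "tau n * \<bar>c i\<bar> \<le> \<bar>c i * tau (Suc i)\<bar>"
        using tau_nonneg[of i] by (simp add: abs_mult mult.commute)
    qed
    also have "\<dots> = norm (D_t ?x)"
    proof -
      interpret D: linear D_t by (rule bounded_linear.linear[OF bounded_linear_D_t])
      have "D_t ?x = (\<Sum>i<n. (c i * tau (Suc i)) *\<^sub>R ell1_unit i)"
        by (simp add: D.sum D.scale D_t_unit)
      then show ?thesis
        by (simp add: norm_unit_sum)
    qed
    also have "\<dots> \<le> norm (A ?x) * b"
      unfolding AB by (rule b(2))
    finally have "tau n * (\<Sum>i<n. \<bar>c i\<bar>) \<le> norm (A ?x) * b" .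
    moreover have "(\<Sum>i<n. c i *\<^sub>R (A (ell1_unit i) /\<^sub>R a)) = A ?x /\<^sub>R a"
      by (simp add: A.sum A.scale scaleR_sum_right mult.commute)
    ultimately show "1 / (a * b) * tau n * (\<Sum>i<n. \<bar>c i\<bar>) \<le> norm (\<Sum>i<n. c i *\<^sub>R (A (ell1_unit i) /\<^sub>R a))"
      using a(1) b(1) by (simp add: field_simps)
  qed
  moreover have "0 < 1 / (a * b)"
    using a(1) b(1) by simp
  ultimately show ?thesis
    using that by blast
qed

text \<open>The superreflexivity hypothesis ranges over spaces carried by subsets of
  \<open>nat \<Rightarrow> real\<close>, so $l_1$ is rebuilt there instead of on the type
  \<open>ell1\<close>.\<close>

definition ell1_nspace :: "(nat \<Rightarrow> real) nspace" where
  "ell1_nspace = \<lparr>carrier = range seq_of_ell1, zero = (\<lambda>k. 0), add = (\<lambda>x y k. x k + y k),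
     scale = (\<lambda>r x k. r * x k), nrm = (\<lambda>x. \<Sum>k. \<bar>x k\<bar>)\<rparr>"

lemma carrier_ell1_nspace: "carrier ell1_nspace = range seq_of_ell1"
  by (simp add: ell1_nspace_def)

lemma ell1_nspace_simps:
  "\<zero>\<^bsub>ell1_nspace\<^esub> = seq_of_ell1 0"
  "seq_of_ell1 x \<oplus>\<^bsub>ell1_nspace\<^esub> seq_of_ell1 y = seq_of_ell1 (x + y)"
  "r \<odot>\<^bsub>ell1_nspace\<^esub> seq_of_ell1 x = seq_of_ell1 (r *\<^sub>R x)"
  "nrm ell1_nspace (seq_of_ell1 x) = norm x"
  by (simp_all add: ell1_nspace_def zero_ell1.rep_eq plus_ell1.rep_eq scaleR_ell1.rep_eq norm_ell1.rep_eq)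

lemma nspace_dist_ell1_nspace: "nspace_dist ell1_nspace (seq_of_ell1 x) (seq_of_ell1 y) = norm (x - y)"
  by (simp add: nspace_dist_def ell1_nspace_simps)

lemma banach_space_ell1_nspace: "banach_space ell1_nspace"
proof
  fix x assume "x \<in> carrier ell1_nspace"
  then obtain a where "x = seq_of_ell1 a"
    by (auto simp: carrier_ell1_nspace)
  then show "\<exists>y\<in>carrier ell1_nspace. x \<oplus>\<^bsub>ell1_nspace\<^esub> y = \<zero>\<^bsub>ell1_nspace\<^esub>"
    by (intro bexI[of _ "seq_of_ell1 (- a)"]) (simp_all add: ell1_nspace_simps carrier_ell1_nspace)
next
  fix s :: "nat \<Rightarrow> nat \<Rightarrow> real"
  assume s: "\<And>n. s n \<in> carrier ell1_nspace"
    and cauchy: "\<And>e. e > 0 \<Longrightarrow> \<exists>N. \<forall>m\<ge>N. \<forall>n\<ge>N. nspace_dist ell1_nspace (s m) (s n) < e"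
  define S where "S n = Abs_ell1 (s n)" for n
  have s_eq: "s n = seq_of_ell1 (S n)" for n
    using s[of n] by (auto simp: S_def carrier_ell1_nspace seq_of_ell1_inverse)
  have "Cauchy S"
    using cauchy by (intro metric_CauchyI) (simp add: s_eq nspace_dist_ell1_nspace dist_norm)
  then obtain l where "S \<longlonglongrightarrow> l"
    by (auto simp: Cauchy_convergent_iff convergent_def)
  then have "(\<lambda>n. norm (S n - l)) \<longlonglongrightarrow> 0"
    by (intro tendsto_norm_zero LIM_zero)
  then show "\<exists>l\<in>carrier ell1_nspace. (\<lambda>n. nspace_dist ell1_nspace (s n) l) \<longlonglongrightarrow> 0"
    by (intro bexI[of _ "seq_of_ell1 l"]) (simp_all add: s_eq nspace_dist_ell1_nspace carrier_ell1_nspace)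
qed (auto simp: carrier_ell1_nspace ell1_nspace_simps seq_of_ell1_inject algebra_simps norm_triangle_ineq)

section \<open>Duals and nonreflexivity of $l_1$\<close>

lemma dual_add:
  assumes "f \<in> carrier (dual X)" "g \<in> carrier (dual X)"
  shows "(\<lambda>x. f x + g x) \<in> carrier (dual X)"
proof -
  obtain K K' where "\<forall>x\<in>carrier X. \<bar>f x\<bar> \<le> K * nrm X x" "\<forall>x\<in>carrier X. \<bar>g x\<bar> \<le> K' * nrm X x"
    using assms by (auto simp: dual_def bounded_operator_def nspace_of_def)
  then have "\<forall>x\<in>carrier X. \<bar>f x + g x\<bar> \<le> (K + K') * nrm X x"
    by (auto simp: distrib_right intro!: order.trans[OF abs_triangle_ineq] add_mono)
  then have "\<exists>K. \<forall>x\<in>carrier X. \<bar>f x + g x\<bar> \<le> K * nrm X x"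
    by blast
  then show ?thesis
    using assms by (simp add: dual_def bounded_operator_def nspace_of_def algebra_simps)
qed

lemma dual_scale:
  assumes "f \<in> carrier (dual X)"
  shows "(\<lambda>x. r * f x) \<in> carrier (dual X)"
proof -
  obtain K where "\<forall>x\<in>carrier X. \<bar>f x\<bar> \<le> K * nrm X x"
    using assms by (auto simp: dual_def bounded_operator_def nspace_of_def)
  then have "\<forall>x\<in>carrier X. \<bar>r * f x\<bar> \<le> (\<bar>r\<bar> * K) * nrm X x"
    by (auto simp: abs_mult mult.assoc intro!: mult_left_mono)
  then have "\<exists>K. \<forall>x\<in>carrier X. \<bar>r * f x\<bar> \<le> K * nrm X x"
    by blast
  then show ?thesis
    using assms by (simp add: dual_def bounded_operator_def nspace_of_def algebra_simps)
qed

text \<open>A real supremum dominates its members only for a set bounded above; the operator bound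
  of \<open>f\<close> provides this on the unit ball.\<close>

lemma abs_le_nrm_dual:
  assumes nonneg: "\<And>x. x \<in> carrier X \<Longrightarrow> 0 \<le> nrm X x"
    and f: "f \<in> carrier (dual X)" and x: "x \<in> unit_ball X"
  shows "\<bar>f x\<bar> \<le> nrm (dual X) f"
proof -
  obtain K where K: "\<forall>x\<in>carrier X. \<bar>f x\<bar> \<le> K * nrm X x"
    using f by (auto simp: dual_def bounded_operator_def nspace_of_def)
  have "\<bar>f y\<bar> \<le> \<bar>K\<bar>" if y: "y \<in> unit_ball X" for y
  proof -
    have "\<bar>f y\<bar> \<le> \<bar>K * nrm X y\<bar>"
      using K y by (force simp: unit_ball_def)
    also have "\<dots> \<le> \<bar>K\<bar>"
      using y nonneg[of y] by (auto simp: abs_mult unit_ball_def intro: mult_left_le)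
    finally show ?thesis .
  qed
  then have "bdd_above ((\<lambda>x. \<bar>f x\<bar>) ` unit_ball X)"
    by (rule bdd_aboveI2)
  then show ?thesis
    using cSUP_upper[OF x] by (simp add: dual_def)
qed

lemma ell1_functional_in_dual:
  assumes g: "bounded_linear g"
  shows "(\<lambda>x. if x \<in> carrier ell1_nspace then g (Abs_ell1 x) else 0) \<in> carrier (dual ell1_nspace)"
proof -
  obtain K where "\<And>x. norm (g x) \<le> norm x * K"
    using bounded_linear.bounded[OF g] by blast
  then have "\<exists>K. \<forall>x. \<bar>g x\<bar> \<le> K * norm x"
    by (metis mult.commute real_norm_def)
  then show ?thesis
    using linear_add[OF bounded_linear.linear[OF g]] linear_scale[OF bounded_linear.linear[OF g]]
    by (auto simp: dual_def bounded_operator_def nspace_of_def carrier_ell1_nspace ell1_nspace_simps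
        seq_of_ell1_inverse)
qed


lemma seq_of_ell1_bounded_linear: "bounded_linear (\<lambda>x. seq_of_ell1 x k)"
  by (rule bounded_linear_intro[where K=1])
    (simp_all add: plus_ell1.rep_eq scaleR_ell1.rep_eq abs_seq_le_norm_ell1)

lemma suminf_ell1_bounded_linear: "bounded_linear (\<lambda>x. \<Sum>k. seq_of_ell1 x k)"
proof (rule bounded_linear_intro[where K=1])
  note summable = summable_rabs_cancel[OF summable_seq_of_ell1]
  show "(\<Sum>k. seq_of_ell1 (x + y) k) = (\<Sum>k. seq_of_ell1 x k) + (\<Sum>k. seq_of_ell1 y k)" for x y
    using summable by (simp add: plus_ell1.rep_eq suminf_add)
  show "(\<Sum>k. seq_of_ell1 (r *\<^sub>R x) k) = r *\<^sub>R (\<Sum>k. seq_of_ell1 x k)" for r x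
    using summable by (simp add: scaleR_ell1.rep_eq suminf_mult)
  show "norm (\<Sum>k. seq_of_ell1 x k) \<le> norm x * 1" for x
    using summable_rabs[OF summable_seq_of_ell1] by (simp add: norm_ell1.rep_eq)
qed

text \<open>A cluster point \<open>\<phi>\<close> of the evaluations at the unit vectors is in the bidual. It vanishes on the
  coordinate functionals but not on the summation functional.\<close>

lemma not_reflexive_ell1_nspace: "\<not> reflexive ell1_nspace"
proof
  assume refl: "reflexive ell1_nspace"
  let ?X = ell1_nspace
  define D where "D = carrier (dual ?X)"
  \<comment> \<open>The value 0 off \<open>D\<close> matches the convention that elements of a dual
    vanish off the carrier.\<close>
  define ev where "ev n f = (if f \<in> D then f (seq_of_ell1 (ell1_unit n)) else 0)" for n and f :: "(nat \<Rightarrow> real) \<Rightarrow> real"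
  \<comment> \<open>As in the Banach-Alaoglu theorem, the dual norms give a product of compact
    intervals that contains all evaluations.\<close>
  define b where "b f = (if f \<in> D then nrm (dual ?X) f else 0)" for f
  define K where "K = {\<phi>. \<forall>f. \<phi> f \<in> {- b f..b f}}"
  have unit: "seq_of_ell1 (ell1_unit n) \<in> unit_ball ?X" for n
    by (simp add: unit_ball_def carrier_ell1_nspace ell1_nspace_simps norm_ell1_unit)
  have ev_K: "ev n \<in> K" for n
  proof -
    have "\<bar>ev n f\<bar> \<le> b f" for f
    proof (cases "f \<in> D")
      case True
      have "0 \<le> nrm ?X x" if "x \<in> carrier ?X" for x
        using that by (auto simp: carrier_ell1_nspace ell1_nspace_simps)
      then show ?thesis
        using abs_le_nrm_dual[of ?X f, OF _ _ unit[of n]] True by (simp add: ev_def b_def D_def)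
    qed (simp add: ev_def b_def)
    then show ?thesis
      by (auto simp: K_def abs_le_iff minus_le_iff)
  qed
  have "compact K"
    unfolding K_def by (rule compact_Pi) simp
  moreover have "filtermap ev sequentially \<noteq> bot"
    by (simp add: filtermap_bot_iff)
  moreover have "eventually (\<lambda>\<phi>. \<phi> \<in> K) (filtermap ev sequentially)"
    by (simp add: eventually_filtermap ev_K)
  ultimately obtain \<phi> where \<phi>: "\<phi> \<in> K" "inf (nhds \<phi>) (filtermap ev sequentially) \<noteq> bot"
    unfolding compact_filter by blast
  \<comment> \<open>Closed conditions holding for almost all evaluations pass to the cluster point.
    Each linearity condition involves only two or three coordinates of the product, hence is
    closed.\<close>
  have limit: "\<phi> \<in> C" if C: "closed C" "\<forall>\<^sub>F n in sequentially. ev n \<in> C" for C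
  proof (rule ccontr)
    assume "\<phi> \<notin> C"
    then have "\<forall>\<^sub>F \<psi> in nhds \<phi>. \<psi> \<notin> C"
      using C(1) by (auto simp: eventually_nhds intro!: exI[of _ "- C"])
    moreover have "\<forall>\<^sub>F \<psi> in filtermap ev sequentially. \<psi> \<in> C"
      using C(2) by (simp add: eventually_filtermap)
    ultimately have "\<forall>\<^sub>F \<psi> in inf (nhds \<phi>) (filtermap ev sequentially). False"
      unfolding eventually_inf by blast
    then show False
      using \<phi>(2) by (simp add: eventually_False)
  qed
  have lim_eq: "\<phi> f = c" if "\<forall>\<^sub>F n in sequentially. ev n f = c" for f c
  proof -
    have "closed {\<psi>. \<psi> f = c}"
      by (intro closed_Collect_eq continuous_on_product_coordinates continuous_on_const)
    from limit[OF this] show ?thesis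
      using that by simp
  qed
  have abs_\<phi>: "\<bar>\<phi> f\<bar> \<le> b f" for f
    using \<phi>(1) by (auto simp: K_def abs_le_iff minus_le_iff)
  have "\<phi> (\<lambda>x. f x + g x) = \<phi> f + \<phi> g" if "f \<in> D" "g \<in> D" for f g
  proof -
    have "closed {\<psi> :: ((nat \<Rightarrow> real) \<Rightarrow> real) \<Rightarrow> real. \<psi> (\<lambda>x. f x + g x) = \<psi> f + \<psi> g}"
      by (intro closed_Collect_eq continuous_on_add continuous_on_product_coordinates)
    from limit[OF this] show ?thesis
      using that dual_add[of f ?X g] by (simp add: ev_def D_def)
  qed
  moreover have "\<phi> (\<lambda>x. r * f x) = r * \<phi> f" if "f \<in> D" for r f
  proof -
    have "closed {\<psi> :: ((nat \<Rightarrow> real) \<Rightarrow> real) \<Rightarrow> real. \<psi> (\<lambda>x. r * f x) = r * \<psi> f}"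
      by (intro closed_Collect_eq continuous_on_mult continuous_on_const continuous_on_product_coordinates)
    from limit[OF this] show ?thesis
      using that dual_scale[of f ?X r] by (simp add: ev_def D_def)
  qed
  moreover have "\<exists>K. \<forall>f\<in>D. \<bar>\<phi> f\<bar> \<le> K * nrm (dual ?X) f"
    using abs_\<phi> by (intro exI[of _ 1]) (metis b_def mult_1)
  moreover have "\<phi> f = 0" if "f \<notin> D" for f
    using abs_\<phi>[of f] that by (simp add: b_def)
  moreover have "add (dual ?X) f g = (\<lambda>x. f x + g x)" "scale (dual ?X) r f = (\<lambda>x. r * f x)" for f g r
    by (simp_all add: dual_def)
  ultimately have "bounded_operator (dual ?X) (nspace_of TYPE(real)) \<phi>" "\<forall>f. f \<notin> carrier (dual ?X) \<longrightarrow> \<phi> f = 0"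
    by (simp_all add: bounded_operator_def nspace_of_def flip: D_def)
  then have "\<phi> \<in> carrier (dual (dual ?X))"
    by (subst dual_def) simp
  then obtain x where x: "\<And>f. f \<in> D \<Longrightarrow> \<phi> f = f (seq_of_ell1 x)"
    using refl unfolding reflexive_def D_def carrier_ell1_nspace by blast
  \<comment> \<open>If \<open>x\<close> represents \<phi>, a functional that is eventually constant
    on the unit vectors takes that constant at \<open>x\<close>.\<close>
  have lim: "g x = c" if g: "bounded_linear g" and c: "\<forall>\<^sub>F n in sequentially. g (ell1_unit n) = c" for g :: "ell1 \<Rightarrow> real" and c
  proof -
    let ?f = "\<lambda>x. if x \<in> carrier ?X then g (Abs_ell1 x) else 0"
    have f: "?f \<in> D"
      unfolding D_def by (rule ell1_functional_in_dual[OF g])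
    then have "ev n ?f = g (ell1_unit n)" for n
      by (simp add: ev_def carrier_ell1_nspace seq_of_ell1_inverse)
    then have "\<phi> ?f = c"
      using c by (intro lim_eq) simp
    then show ?thesis
      using x[OF f] by (simp add: carrier_ell1_nspace seq_of_ell1_inverse)
  qed
  have "seq_of_ell1 x k = 0" for k
  proof (rule lim[OF seq_of_ell1_bounded_linear])
    show "\<forall>\<^sub>F n in sequentially. seq_of_ell1 (ell1_unit n) k = 0"
      using eventually_gt_at_top[of k] by eventually_elim (simp add: ell1_unit.rep_eq)
  qed
  moreover have "(\<Sum>k. seq_of_ell1 (ell1_unit n) k) = 1" for n
    unfolding ell1_unit.rep_eq using suminf_finite[of "{n}" "\<lambda>k. if k = n then 1 else 0 :: real"] by simp
  then have "(\<Sum>k. seq_of_ell1 x k) = 1"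
    by (intro lim[OF suminf_ell1_bounded_linear]) simp
  ultimately show False
    by simp
qed

text \<open>Equivalence of norms in finite dimension: the norm attains its minimum on the compact
  set of coefficients with absolute sum 1, and independence makes the minimum positive.\<close>

lemma norm_sum_ge_independent:
  fixes B :: "'a::real_normed_vector set"
  assumes B: "finite B" "independent B"
  obtains m where "0 < m" "\<And>c. m * (\<Sum>b\<in>B. \<bar>c b\<bar>) \<le> norm (\<Sum>b\<in>B. c b *\<^sub>R b)"
proof (cases "B = {}")
  case False
  \<comment> \<open>Fixing the coefficients outside \<open>B\<close> to 0 makes this set compact in
    the full function space.\<close>
  define S where "S = {c. \<forall>b. c b \<in> (if b \<in> B then {-1..1::real} else {0})} \<inter> {c. (\<Sum>b\<in>B. \<bar>c b\<bar>) = 1}"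
  have "closed {c :: 'a \<Rightarrow> real. (\<Sum>b\<in>B. \<bar>c b\<bar>) = 1}"
    by (intro closed_Collect_eq continuous_intros continuous_on_product_coordinates)
  then have "compact S"
    unfolding S_def by (intro compact_Int_closed compact_Pi) auto
  have in_S: "(\<lambda>b. if b \<in> B then c b / s else 0) \<in> S"
    if s: "s = (\<Sum>b\<in>B. \<bar>c b\<bar>)" "0 < s" for c s
  proof -
    have "\<bar>c b\<bar> \<le> s" if "b \<in> B" for b
      unfolding s(1) using that B(1) by (intro member_le_sum) auto
    then have "c b / s \<in> {-1..1}" if "b \<in> B" for b
      using that s(2) by (auto simp: abs_le_iff divide_le_eq le_divide_eq minus_le_iff)
    moreover have "(\<Sum>b\<in>B. \<bar>c b / s\<bar>) = (\<Sum>b\<in>B. \<bar>c b\<bar>) / s"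
      using s(2) by (simp add: sum_divide_distrib)
    ultimately show ?thesis
      using s by (simp add: S_def)
  qed
  have "0 < (\<Sum>b\<in>B. \<bar>1::real\<bar>)"
    using B(1) False by (simp add: card_gt_0_iff)
  from in_S[OF refl this] have "S \<noteq> {}"
    by blast
  moreover have "continuous_on S (\<lambda>c. norm (\<Sum>b\<in>B. c b *\<^sub>R b))"
    by (intro continuous_intros continuous_on_subset[OF continuous_on_product_coordinates]) auto
  ultimately obtain c0 where c0: "c0 \<in> S" "\<And>c. c \<in> S \<Longrightarrow> norm (\<Sum>b\<in>B. c0 b *\<^sub>R b) \<le> norm (\<Sum>b\<in>B. c b *\<^sub>R b)"
    using continuous_attains_inf[OF \<open>compact S\<close>] by blast
  have "(\<Sum>b\<in>B. c0 b *\<^sub>R b) \<noteq> 0"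
  proof
    assume "(\<Sum>b\<in>B. c0 b *\<^sub>R b) = 0"
    then have "\<forall>b\<in>B. c0 b = 0"
      using independentD[OF B(2) B(1) subset_refl] by blast
    then show False
      using c0(1) by (simp add: S_def)
  qed
  moreover have "norm (\<Sum>b\<in>B. c0 b *\<^sub>R b) * (\<Sum>b\<in>B. \<bar>c b\<bar>) \<le> norm (\<Sum>b\<in>B. c b *\<^sub>R b)" for c
  proof (cases "(\<Sum>b\<in>B. \<bar>c b\<bar>) = 0")
    case ne: False
    define s where "s = (\<Sum>b\<in>B. \<bar>c b\<bar>)"
    have s: "0 < s"
      using ne sum_nonneg[of B "\<lambda>b. \<bar>c b\<bar>"] abs_ge_zero less_le unfolding s_def by metis
    have "norm (\<Sum>b\<in>B. c0 b *\<^sub>R b) \<le> norm (\<Sum>b\<in>B. (c b / s) *\<^sub>R b)"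
      using c0(2)[OF in_S[OF s_def s]] by (simp cong: sum.cong)
    also have "(\<Sum>b\<in>B. (c b / s) *\<^sub>R b) = (\<Sum>b\<in>B. c b *\<^sub>R b) /\<^sub>R s"
      by (simp add: scaleR_sum_right divide_inverse mult.commute)
    finally show ?thesis
      using s by (simp add: field_simps flip: s_def)
  qed simp
  ultimately show ?thesis
    using that by (metis zero_less_norm_iff)
qed (use that[of 1] in simp)

text \<open>Tails of finitely many basis vectors are small simultaneously, and the coefficients of
  \<open>x\<close> have absolute sum at most \<open>norm x / m\<close>. Hence one cut-off serves the
  whole span.\<close>

lemma ell1_truncation_uniform:
  assumes B: "finite B" and \<delta>: "0 < \<delta>"
  obtains n where "\<And>x. x \<in> span B \<Longrightarrow> (1 - \<delta>) * norm x \<le> (\<Sum>k<n. \<bar>seq_of_ell1 x k\<bar>)"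
proof -
  obtain C where C: "C \<subseteq> B" "independent C" "B \<subseteq> span C"
    using maximal_independent_subset by blast
  have "finite C"
    using B C(1) finite_subset by blast
  have span: "span B \<subseteq> span C"
    using C(3) by (simp add: span_minimal)
  obtain m where m: "0 < m" "\<And>c. m * (\<Sum>b\<in>C. \<bar>c b\<bar>) \<le> norm (\<Sum>b\<in>C. c b *\<^sub>R b)"
    using norm_sum_ge_independent[OF \<open>finite C\<close> C(2)] by blast
  define t where "t n x = (\<Sum>k. \<bar>seq_of_ell1 x (k + n)\<bar>)" for n x
  have t: "norm x = t n x + (\<Sum>k<n. \<bar>seq_of_ell1 x k\<bar>)" for n x
    unfolding t_def norm_ell1.rep_eq by (rule suminf_split_initial_segment[OF summable_seq_of_ell1])
  have summable_t: "summable (\<lambda>k. \<bar>seq_of_ell1 x (k + n)\<bar>)" for n x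
    using summable_seq_of_ell1[of x] by (rule summable_ignore_initial_segment)
  have t_add: "t n (x + y) \<le> t n x + t n y" for n x y
    unfolding t_def using summable_t
    by (subst suminf_add) (auto simp: plus_ell1.rep_eq abs_summable_add intro!: suminf_le summable_add)
  have t_scale: "t n (r *\<^sub>R x) = \<bar>r\<bar> * t n x" for n r x
    unfolding t_def using summable_t by (simp add: scaleR_ell1.rep_eq abs_mult suminf_mult)
  have t_sum: "t n (\<Sum>b\<in>A. c b *\<^sub>R b) \<le> (\<Sum>b\<in>A. \<bar>c b\<bar> * t n b)" if "finite A" for n A c
    using that
  proof induction
    case (insert b A)
    then show ?case
      using t_add[of n "c b *\<^sub>R b" "\<Sum>b\<in>A. c b *\<^sub>R b"] by (simp add: t_scale)
  qed (simp add: t_def zero_ell1.rep_eq)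
  have "\<forall>\<^sub>F n in sequentially. t n b < \<delta> * m" for b
  proof -
    have "(\<lambda>n. \<Sum>k<n. \<bar>seq_of_ell1 b k\<bar>) \<longlonglongrightarrow> norm b"
      unfolding norm_ell1.rep_eq by (rule summable_LIMSEQ[OF summable_seq_of_ell1])
    then have "\<forall>\<^sub>F n in sequentially. norm b - \<delta> * m < (\<Sum>k<n. \<bar>seq_of_ell1 b k\<bar>)"
      using \<delta> m(1) by (intro order_tendstoD) auto
    then show ?thesis
      by eventually_elim (use t[of b] in smt)
  qed
  then have "\<forall>\<^sub>F n in sequentially. \<forall>b\<in>C. t n b < \<delta> * m"
    using \<open>finite C\<close> by (simp add: eventually_ball_finite)
  then obtain n where n: "\<And>b. b \<in> C \<Longrightarrow> t n b < \<delta> * m"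
    unfolding eventually_sequentially by blast
  have "(1 - \<delta>) * norm x \<le> (\<Sum>k<n. \<bar>seq_of_ell1 x k\<bar>)" if x: "x \<in> span B" for x
  proof -
    obtain c where c: "x = (\<Sum>b\<in>C. c b *\<^sub>R b)"
      using subsetD[OF span x] unfolding span_finite[OF \<open>finite C\<close>] by (elim rangeE)
    have "t n x \<le> (\<Sum>b\<in>C. \<bar>c b\<bar> * t n b)"
      unfolding c by (rule t_sum[OF \<open>finite C\<close>])
    also have "\<dots> \<le> (\<Sum>b\<in>C. \<bar>c b\<bar> * (\<delta> * m))"
      using n by (intro sum_mono mult_left_mono) (auto intro: less_imp_le)
    also have "\<dots> = \<delta> * (m * (\<Sum>b\<in>C. \<bar>c b\<bar>))"
      by (simp add: sum_distrib_left sum_distrib_right mult_ac)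
    also have "\<dots> \<le> \<delta> * norm x"
      unfolding c using \<delta> m(2) by (intro mult_left_mono) auto
    finally show ?thesis
      using t[of x n] by (simp add: algebra_simps)
  qed
  then show ?thesis
    using that by blast
qed

lemma finite_dim_subspace_ell1_nspace:
  assumes "finite_dim_subspace E ell1_nspace"
  obtains B where "finite B" "E \<subseteq> seq_of_ell1 ` span B"
proof -
  obtain B where B: "finite B" "B \<subseteq> range seq_of_ell1"
    and E: "E = \<Inter> {S. subspace_of S ell1_nspace \<and> B \<subseteq> S}"
    using assms by (auto simp: finite_dim_subspace_def carrier_ell1_nspace)
  obtain C where C: "finite C" "B = seq_of_ell1 ` C"
    using finite_subset_image[OF B] by blast
  have "subspace_of (seq_of_ell1 ` span C) ell1_nspace"
    by (auto simp: subspace_of_def carrier_ell1_nspace ell1_nspace_simps span_add span_scale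
        intro!: imageI span_zero)
  then have "E \<subseteq> seq_of_ell1 ` span C"
    unfolding E C(2) using span_superset by blast
  then show ?thesis
    using that C(1) by blast
qed

lemma finitely_representable_ell1_nspace:
  assumes l1: "\<And>n \<beta>. 0 < \<beta> \<Longrightarrow> \<beta> < 1 \<Longrightarrow> contains_l1 TYPE('z::real_normed_vector) n \<beta>"
  shows "finitely_representable ell1_nspace (nspace_of TYPE('z))"
  unfolding finitely_representable_def
proof (intro allI impI, elim conjE)
  fix E and \<epsilon> :: real
  assume E: "finite_dim_subspace E ell1_nspace" and \<epsilon>: "\<epsilon> > 0"
  \<comment> \<open>One factor \<open>s\<close> is lost by truncation and one in the copy of
    $l_1^n$; scaling \<open>u\<close> by 1 + \<epsilon> = 1/s^2 makes up for both.\<close>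
  define s where "s = 1 / sqrt (1 + \<epsilon>)"
  have s: "0 < s" "s < 1" and s_sq: "s * s = 1 / (1 + \<epsilon>)"
    using \<epsilon> by (simp_all add: s_def)
  obtain B where B: "finite B" "E \<subseteq> seq_of_ell1 ` span B"
    using finite_dim_subspace_ell1_nspace[OF E] by blast
  obtain n where n: "\<And>x. x \<in> span B \<Longrightarrow> s * norm x \<le> (\<Sum>k<n. \<bar>seq_of_ell1 x k\<bar>)"
    using ell1_truncation_uniform[OF B(1), of "1 - s"] s by auto
  obtain z :: "nat \<Rightarrow> 'z" where z: "\<And>i. i < n \<Longrightarrow> norm (z i) \<le> 1"
    and low: "\<And>a. s * (\<Sum>i<n. \<bar>a i\<bar>) \<le> norm (\<Sum>i<n. a i *\<^sub>R z i)"
    using l1[OF s, of n] unfolding contains_l1_def by blast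
  define u where "u x = (1 + \<epsilon>) *\<^sub>R (\<Sum>i<n. x i *\<^sub>R z i)" for x
  have u: "norm x \<le> norm (u (seq_of_ell1 x)) \<and> norm (u (seq_of_ell1 x)) \<le> (1 + \<epsilon>) * norm x"
    if "x \<in> span B" for x
  proof
    have "s * (s * norm x) \<le> s * (\<Sum>k<n. \<bar>seq_of_ell1 x k\<bar>)"
      using n[OF that] s by (intro mult_left_mono) auto
    also have "\<dots> \<le> norm (\<Sum>i<n. seq_of_ell1 x i *\<^sub>R z i)"
      by (rule low)
    finally have "(1 + \<epsilon>) * ((s * s) * norm x) \<le> norm (u (seq_of_ell1 x))"
      using \<epsilon> by (simp add: u_def mult.assoc)
    then show "norm x \<le> norm (u (seq_of_ell1 x))"
      unfolding s_sq using \<epsilon> by simp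
    have "norm (\<Sum>i<n. seq_of_ell1 x i *\<^sub>R z i) \<le> (\<Sum>i<n. \<bar>seq_of_ell1 x i\<bar>)"
      using z by (intro sum_norm_le) (auto intro: mult_left_le)
    also have "\<dots> \<le> norm x"
      by (rule sum_le_norm_ell1)
    finally show "norm (u (seq_of_ell1 x)) \<le> (1 + \<epsilon>) * norm x"
      using \<epsilon> by (simp add: u_def)
  qed
  then have bound: "\<forall>x\<in>E. nrm ell1_nspace x \<le> norm (u x) \<and> norm (u x) \<le> (1 + \<epsilon>) * nrm ell1_nspace x"
    using B(2) by (auto simp: ell1_nspace_simps dest!: subsetD)
  moreover have "bounded_operator (ell1_nspace\<lparr>carrier := E\<rparr>) (nspace_of TYPE('z)) u"
    unfolding bounded_operator_def
  proof (intro conjI)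
    show "\<exists>K. \<forall>x\<in>carrier (ell1_nspace\<lparr>carrier := E\<rparr>).
        nrm (nspace_of TYPE('z)) (u x) \<le> K * nrm (ell1_nspace\<lparr>carrier := E\<rparr>) x"
      using bound by (intro exI[of _ "1 + \<epsilon>"]) (simp add: nspace_of_def)
  qed (auto simp: nspace_of_def ell1_nspace_def u_def scaleR_add_left sum.distrib scaleR_add_right
      scaleR_sum_right mult_ac)
  ultimately show "\<exists>u. bounded_operator (ell1_nspace\<lparr>carrier := E\<rparr>) (nspace_of TYPE('z)) u \<and>
      (\<forall>x\<in>E. nrm ell1_nspace x \<le> nrm (nspace_of TYPE('z)) (u x) \<and>
        nrm (nspace_of TYPE('z)) (u x) \<le> (1 + \<epsilon>) * nrm ell1_nspace x)"
    by (intro exI[of _ u]) (simp add: nspace_of_def)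
qed

lemma not_factors_through_superreflexive:
  assumes "superreflexive TYPE(nat \<Rightarrow> real) (nspace_of TYPE('z::real_normed_vector))"
  shows "\<not> factors_through TYPE('z) D_t"
proof
  assume "factors_through TYPE('z) D_t"
  then obtain \<kappa> where "0 < \<kappa>" "\<And>n. 1 \<le> n \<Longrightarrow> contains_l1 TYPE('z) n (\<kappa> * tau n)"
    using factors_through_contains_l1 by blast
  from finitely_representable_ell1_nspace[OF contains_l1_if_logarithmic[OF this]]
  have "finitely_representable ell1_nspace (nspace_of TYPE('z))"
    by simp
  then show False
    using assms banach_space_ell1_nspace not_reflexive_ell1_nspace
    unfolding superreflexive_def by blast
qed

theorem mainTheorem2:
  shows "super_weakly_compact TYPE('i) D_t \<and>
    (\<forall>p>1. \<not> martingale_type p D_t) \<and>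
    (superreflexive TYPE(nat \<Rightarrow> real) (nspace_of TYPE('z::banach)) \<longrightarrow>
       \<not> factors_through TYPE('z) D_t)"
  using super_weakly_compactI[OF bounded_linear_D_t compact_D_t_cball] not_martingale_type_D_t
    not_factors_through_superreflexive
  by blast

end
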